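(* Let $\alpha\in\mathbb{R}\setminus\mathbb{Q}$, let $V(x)=\sum_{k=-d}^{d}V_ke^{2\pi ikx}$ be a real trigonometric polynomial, and let $\varepsilon\in\mathbb{R}$. For any $z\in\mathbb{C}\setminus\mathbb{R}$ (and $n\in\mathbb{Z}$), one has $$\int_{\mathbb{T}}\langle (H_{V(\cdot+i\varepsilon),x,\alpha}-z)^{-1}\delta_n,\delta_n\rangle\, dx=\int_{\mathbb{T}}\langle (\widehat{H}_{V(\cdot+i\varepsilon),\theta,\alpha}-z)^{-1}\delta_n,\delta_n\rangle\, d\theta .$$
   Context: $\mathbb{T}=\mathbb{R}/\mathbb{Z}$; $\{\delta_n\}_{n\in\mathbb{Z}}$ is the standard basis of $\ell^2(\mathbb{Z})$. The (in general non-self-adjoint) quasiperiodic Schrödinger operator and its Aubry dual on $\ell^2(\mathbb{Z})$ are $$(H_{V(\cdot+i\varepsilon),x,\alpha}u)_n=u_{n+1}+u_{n-1}+V(x+i\varepsilon+n\alpha)u_n,$$ $$(\widehat{H}_{V(\cdot+i\varepsilon),\theta,\alpha}u)_n=\sum_{k=-d}^{d} e^{-2\pi k\varepsilon}V_k u_{n+k}+2\cos2\pi(\theta+n\alpha)\,u_n .$$ *)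

theory Defs
  imports "HOL-Analysis.Analysis"
begin

definition ell2 :: "(int \<Rightarrow> complex) set" where
  "ell2 = {u. (\<lambda>n. (cmod (u n))\<^sup>2) summable_on UNIV}"

definition ell2_norm :: "(int \<Rightarrow> complex) \<Rightarrow> real" where
  "ell2_norm u = sqrt (\<Sum>\<^sub>\<infinity>n. (cmod (u n))\<^sup>2)"

definition ell2_inner :: "(int \<Rightarrow> complex) \<Rightarrow> (int \<Rightarrow> complex) \<Rightarrow> complex" where
  "ell2_inner u v = (\<Sum>\<^sub>\<infinity>n. u n * cnj (v n))"

definition ell2_basis :: "int \<Rightarrow> int \<Rightarrow> complex" where
  "ell2_basis n = (\<lambda>m. if m = n then 1 else 0)"

text \<open>An operator on \<open>\<ell>\<^sup>2(\<int>)\<close> is a map on all sequences of which only the restriction to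
  \<^const>\<open>ell2\<close> is used. The spectral parameter \<open>z\<close> is in the resolvent set of \<open>A\<close> if \<open>A - z\<close> is
  a bijection of \<open>\<ell>\<^sup>2(\<int>)\<close> with bounded inverse.\<close>

definition resolvent_set ::
    "((int \<Rightarrow> complex) \<Rightarrow> (int \<Rightarrow> complex)) \<Rightarrow> complex set" where
  "resolvent_set A =
     {z. bij_betw (\<lambda>u n. A u n - z * u n) ell2 ell2 \<and>
         (\<exists>C. \<forall>u\<in>ell2. ell2_norm u \<le> C * ell2_norm (\<lambda>n. A u n - z * u n))}"

text \<open>\<open>(A - z)\<^sup>-\<^sup>1\<close>, made total by the value \<open>0\<close> when \<open>z\<close> lies in the spectrum of \<open>A\<close>. The operators
  below are not self-adjoint in general, so their spectra may contain non-real points.\<close>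

definition resolvent ::
    "((int \<Rightarrow> complex) \<Rightarrow> (int \<Rightarrow> complex)) \<Rightarrow> complex \<Rightarrow> (int \<Rightarrow> complex) \<Rightarrow> (int \<Rightarrow> complex)" where
  "resolvent A z v =
     (if z \<in> resolvent_set A then inv_into ell2 (\<lambda>u n. A u n - z * u n) v else (\<lambda>n. 0))"

text \<open>Only the coefficients \<open>V k\<close> with \<open>-d \<le> k \<le> d\<close> matter. The argument is complex, because
  the polynomial is evaluated at \<open>x + i\<epsilon>\<close>.\<close>

definition trig_poly :: "nat \<Rightarrow> (int \<Rightarrow> complex) \<Rightarrow> complex \<Rightarrow> complex" where
  "trig_poly d V w = (\<Sum>k = - int d..int d. V k * exp (2 * of_real pi * \<i> * of_int k * w))"

definition real_trig_poly :: "nat \<Rightarrow> (int \<Rightarrow> complex) \<Rightarrow> bool" where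
  "real_trig_poly d V \<longleftrightarrow> (\<forall>x::real. trig_poly d V (of_real x) \<in> \<real>)"

definition schrodinger_op ::
    "(complex \<Rightarrow> complex) \<Rightarrow> real \<Rightarrow> real \<Rightarrow> real \<Rightarrow> (int \<Rightarrow> complex) \<Rightarrow> (int \<Rightarrow> complex)" where
  "schrodinger_op v \<epsilon> x \<alpha> u =
     (\<lambda>n. u (n + 1) + u (n - 1) + v (of_real x + \<i> * of_real \<epsilon> + of_int n * of_real \<alpha>) * u n)"

definition aubry_dual_op ::
    "nat \<Rightarrow> (int \<Rightarrow> complex) \<Rightarrow> real \<Rightarrow> real \<Rightarrow> real \<Rightarrow> (int \<Rightarrow> complex) \<Rightarrow> (int \<Rightarrow> complex)" where
  "aubry_dual_op d V \<epsilon> \<theta> \<alpha> u =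
     (\<lambda>n. (\<Sum>k = - int d..int d. of_real (exp (- 2 * pi * of_int k * \<epsilon>)) * V k * u (n + k))
          + of_real (2 * cos (2 * pi * (\<theta> + of_int n * \<alpha>))) * u n)"

text \<open>The integral over \<open>\<real>/\<int>\<close> of a function given as a 1-periodic function on \<open>\<real>\<close>.\<close>

definition torus_integral :: "(real \<Rightarrow> complex) \<Rightarrow> complex" where
  "torus_integral f = (LINT x:{0..<1}|lborel. f x)"

end

theory Submission
  imports Defs
begin

text \<open>
Write \<open>e t = exp (2 \<pi> \<i> t)\<close>. Both families are given by finitely many coefficients \<open>a (k, j)\<close>,
through
  \<open>(A\<^sub>x u) n = (\<Sum>(k, j). a (k, j) * e (j * (x + n * \<alpha>)) * u (n + k))\<close>,
where the spectral parameter is absorbed into \<open>a (0, 0)\<close>. The array \<open>a\<close> is an element of the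
rotation algebra, generated by the shift and by the multiplication with \<open>e x\<close>, and \<open>A\<^sub>x\<close> is its
representation at the phase \<open>x\<close>. Aubry duality is the automorphism given by a quarter turn of the
index lattice, and the integral of a diagonal matrix element over the phase is the
canonical trace, which the automorphism preserves. The two sides of the theorem are thus the trace
of an inverse and the trace of its image.

To make this precise without Fourier analysis of operator-valued functions, multiplication by \<open>e x\<close>
is replaced by a shift in a second integer variable. This gives an operator \<open>B\<close> on finitely
supported functions on \<open>\<int>\<^sup>2\<close>; summing such a function \<open>u (n, l)\<close> against \<open>e (l * x)\<close> over \<open>l\<close>
yields a function of \<open>n\<close>, its fiber at \<open>x\<close>, and turns \<open>B\<close> into \<open>A\<^sub>x\<close>
(lemma \<open>fiber_lattice_op\<close>). A quarter turn of \<open>\<int>\<^sup>2\<close>, multiplied by suitable phases, conjugates the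
operator \<open>B\<close> of \<open>a\<close> into that of the dual array (lemma \<open>duality_lattice_op\<close>).

Invertibility is the same for both families, and for all phases. An operator on \<open>\<ell>\<^sup>2\<close> is
invertible as soon as it and its adjoint are bounded below, and such a lower bound can be moved
around. From one phase it spreads to the orbit under translations by \<open>\<alpha>\<close>, and from there, by
continuity, to all phases, because the orbit is dense modulo 1 (lemma
\<open>bounded_below_if_single_fiber\<close>). From all phases it passes to \<open>B\<close> by Parseval's identity, and back
by testing \<open>B\<close> on wave packets (lemmas \<open>lattice_bounded_below_if_bounded_below\<close> and
\<open>bounded_below_if_lattice_bounded_below\<close>). Between \<open>B\<close> and its dual it is carried by the quarter
turn. In particular, if \<open>z\<close> is in the spectrum for one phase of one of the families, then it is in
the spectrum for all phases of both, and both integrands vanish.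

In the invertible case, \<open>A\<^sub>x g = \<delta>\<^sub>n\<close> is solved by the iteration \<open>r \<mapsto> r - t * A\<^sub>x (A\<^sub>x\<^sup>* r)\<close> for the
residual, which for small \<open>t\<close> contracts with a factor independent of \<open>x\<close>. Every approximate solution
is a fiber of a finitely supported function on \<open>\<int>\<^sup>2\<close>, computed by the same iteration with \<open>B\<close>; hence
the integral of its \<open>n\<close>-th entry is the value of that function at \<open>(n, 0)\<close>. The quarter turn,
centred so as to fix \<open>\<delta>\<close> at \<open>(n, 0)\<close>, carries the iteration for \<open>a\<close> to the iteration for its dual
and does not change these values, so the two integrals are limits of the same sequence.
\<close>

section \<open>Square-summable sequences\<close>

lemma ell2_partial_sum_le:
  assumes "u \<in> ell2" "finite F"
  shows "L2_set (\<lambda>n. cmod (u n)) F \<le> ell2_norm u"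
  unfolding L2_set_def ell2_norm_def
  using assms by (intro real_sqrt_le_mono finite_sum_le_infsum) (auto simp: ell2_def)

lemma ell2_if_partial_sums_le:
  assumes "\<And>F. finite F \<Longrightarrow> L2_set (\<lambda>n. cmod (u n)) F \<le> K"
  shows "u \<in> ell2" and "ell2_norm u \<le> K"
proof -
  have K: "0 \<le> K"
    using assms[of "{}"] by simp
  have le: "(\<Sum>n\<in>F. (cmod (u n))\<^sup>2) \<le> K\<^sup>2" if "finite F" for F
    using assms[OF that] K sqrt_le_D unfolding L2_set_def by blast
  show u: "u \<in> ell2"
    unfolding ell2_def mem_Collect_eq
    by (rule nonneg_bdd_above_summable_on) (auto intro!: bdd_aboveI[where M = "K\<^sup>2"] le)
  have "(\<Sum>\<^sub>\<infinity>n. (cmod (u n))\<^sup>2) \<le> K\<^sup>2"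
    using u by (intro infsum_le_finite_sums) (auto simp: ell2_def le)
  thus "ell2_norm u \<le> K"
    unfolding ell2_norm_def using K by (metis real_sqrt_le_mono real_sqrt_unique)
qed

lemma ell2_norm_nonneg: "0 \<le> ell2_norm u"
  unfolding ell2_norm_def by (simp add: infsum_nonneg)

lemma ell2_norm_power2: "(ell2_norm u)\<^sup>2 = (\<Sum>\<^sub>\<infinity>n. (cmod (u n))\<^sup>2)"
  unfolding ell2_norm_def by (simp add: infsum_nonneg)

lemma norm_le_ell2_norm:
  assumes "u \<in> ell2"
  shows "cmod (u n) \<le> ell2_norm u"
  using ell2_partial_sum_le[OF assms, of "{n}"] by (simp add: L2_set_def)

lemma ell2_add:
  assumes "u \<in> ell2" "v \<in> ell2"
  shows "(\<lambda>n. u n + v n) \<in> ell2"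
    and "ell2_norm (\<lambda>n. u n + v n) \<le> ell2_norm u + ell2_norm v"
proof -
  have le: "L2_set (\<lambda>n. cmod (u n + v n)) F \<le> ell2_norm u + ell2_norm v" if "finite F" for F
  proof -
    have "L2_set (\<lambda>n. cmod (u n + v n)) F \<le> L2_set (\<lambda>n. cmod (u n) + cmod (v n)) F"
      by (intro L2_set_mono norm_triangle_ineq) auto
    also have "\<dots> \<le> L2_set (\<lambda>n. cmod (u n)) F + L2_set (\<lambda>n. cmod (v n)) F"
      by (rule L2_set_triangle_ineq)
    also have "\<dots> \<le> ell2_norm u + ell2_norm v"
      using assms that by (intro add_mono ell2_partial_sum_le)
    finally show ?thesis .
  qed
  show "(\<lambda>n. u n + v n) \<in> ell2" "ell2_norm (\<lambda>n. u n + v n) \<le> ell2_norm u + ell2_norm v"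
    using ell2_if_partial_sums_le[where u = "\<lambda>n. u n + v n", OF le] by auto
qed

lemma ell2_scale:
  assumes "u \<in> ell2"
  shows "(\<lambda>n. c * u n) \<in> ell2" and "ell2_norm (\<lambda>n. c * u n) = cmod c * ell2_norm u"
proof -
  show "(\<lambda>n. c * u n) \<in> ell2"
    using assms by (auto simp: ell2_def norm_mult power_mult_distrib intro: summable_on_cmult_right)
  show "ell2_norm (\<lambda>n. c * u n) = cmod c * ell2_norm u"
    by (simp add: ell2_norm_def norm_mult power_mult_distrib infsum_cmult_right' real_sqrt_mult)
qed

lemma ell2_diff:
  assumes "u \<in> ell2" "v \<in> ell2"
  shows "(\<lambda>n. u n - v n) \<in> ell2"
    and "ell2_norm (\<lambda>n. u n - v n) \<le> ell2_norm u + ell2_norm v"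
  using ell2_add[OF assms(1) ell2_scale(1)[OF assms(2), of "-1"]] ell2_scale(2)[OF assms(2), of "-1"]
  by simp_all

lemma ell2_norm_diff_commute: "ell2_norm (\<lambda>n. u n - v n) = ell2_norm (\<lambda>n. v n - u n)"
  by (simp add: ell2_norm_def norm_minus_commute)

lemma ell2_norm_diff_le_zero_imp_eq:
  assumes "u \<in> ell2" "v \<in> ell2" "ell2_norm (\<lambda>n. u n - v n) \<le> 0"
  shows "u = v"
proof
  fix n
  have "cmod (u n - v n) \<le> 0"
    using norm_le_ell2_norm[OF ell2_diff(1)[OF assms(1,2)]] assms(3) by (rule order_trans)
  thus "u n = v n" by simp
qed

lemma ell2_zero: "(\<lambda>n. 0) \<in> ell2" "ell2_norm (\<lambda>n. 0) = 0"
  by (simp_all add: ell2_def ell2_norm_def)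

lemma ell2_sum:
  assumes "finite I" "\<And>i. i \<in> I \<Longrightarrow> f i \<in> ell2"
  shows "(\<lambda>n. \<Sum>i\<in>I. f i n) \<in> ell2"
    and "ell2_norm (\<lambda>n. \<Sum>i\<in>I. f i n) \<le> (\<Sum>i\<in>I. ell2_norm (f i))"
proof -
  have "(\<lambda>n. \<Sum>i\<in>I. f i n) \<in> ell2 \<and> ell2_norm (\<lambda>n. \<Sum>i\<in>I. f i n) \<le> (\<Sum>i\<in>I. ell2_norm (f i))"
    using assms
  proof (induction I rule: finite_induct)
    case (insert i I)
    then show ?case
      using ell2_add[of "f i" "\<lambda>n. \<Sum>i\<in>I. f i n"] by fastforce
  qed (simp add: ell2_zero)
  thus "(\<lambda>n. \<Sum>i\<in>I. f i n) \<in> ell2"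
    and "ell2_norm (\<lambda>n. \<Sum>i\<in>I. f i n) \<le> (\<Sum>i\<in>I. ell2_norm (f i))" by auto
qed

lemma bij_int_shift: "bij (\<lambda>n::int. n + k)"
  by (rule bij_betwI[where g = "\<lambda>n. n - k"]) auto

lemma ell2_weighted_shift:
  assumes "u \<in> ell2" "\<And>n. cmod (c n) = r"
  shows "(\<lambda>n. c n * u (n + k)) \<in> ell2" and "ell2_norm (\<lambda>n. c n * u (n + k)) = r * ell2_norm u"
proof -
  have eq: "(cmod (c n * u (n + k)))\<^sup>2 = r\<^sup>2 * (cmod (u (n + k)))\<^sup>2" for n
    by (simp add: norm_mult power_mult_distrib assms(2))
  have "(\<lambda>n. (cmod (u (n + k)))\<^sup>2) summable_on UNIV"
    using assms(1) summable_on_reindex_bij_betw[OF bij_int_shift, of "\<lambda>n. (cmod (u n))\<^sup>2"]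
    by (simp add: ell2_def)
  thus "(\<lambda>n. c n * u (n + k)) \<in> ell2"
    unfolding ell2_def mem_Collect_eq eq by (rule summable_on_cmult_right)
  have "0 \<le> r"
    using assms(2)[of 0] norm_ge_zero[of "c 0"] by simp
  moreover have "(\<Sum>\<^sub>\<infinity>n. (cmod (u (n + k)))\<^sup>2) = (\<Sum>\<^sub>\<infinity>n. (cmod (u n))\<^sup>2)"
    using infsum_reindex_bij_betw[OF bij_int_shift, of "\<lambda>n. (cmod (u n))\<^sup>2"] .
  ultimately show "ell2_norm (\<lambda>n. c n * u (n + k)) = r * ell2_norm u"
    unfolding ell2_norm_def eq infsum_cmult_right' by (simp add: real_sqrt_mult)
qed

lemma ell2_prod_abs_summable:
  assumes "u \<in> ell2" "v \<in> ell2"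
  shows "(\<lambda>n. cmod (u n * cnj (v n))) summable_on UNIV"
    and "(\<Sum>\<^sub>\<infinity>n. cmod (u n * cnj (v n))) \<le> ell2_norm u * ell2_norm v"
proof -
  have le: "(\<Sum>n\<in>F. cmod (u n * cnj (v n))) \<le> ell2_norm u * ell2_norm v" if "finite F" for F
  proof -
    have "(\<Sum>n\<in>F. cmod (u n * cnj (v n))) = (\<Sum>n\<in>F. \<bar>cmod (u n)\<bar> * \<bar>cmod (v n)\<bar>)"
      by (simp add: norm_mult)
    also have "\<dots> \<le> L2_set (\<lambda>n. cmod (u n)) F * L2_set (\<lambda>n. cmod (v n)) F"
      by (rule L2_set_mult_ineq)
    also have "\<dots> \<le> ell2_norm u * ell2_norm v"
      using assms that by (intro mult_mono ell2_partial_sum_le) (auto simp: ell2_norm_nonneg)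
    finally show ?thesis .
  qed
  show s: "(\<lambda>n. cmod (u n * cnj (v n))) summable_on UNIV"
    by (rule nonneg_bdd_above_summable_on)
       (auto intro!: bdd_aboveI[where M = "ell2_norm u * ell2_norm v"] le)
  show "(\<Sum>\<^sub>\<infinity>n. cmod (u n * cnj (v n))) \<le> ell2_norm u * ell2_norm v"
    using s le by (rule infsum_le_finite_sums)
qed

lemma ell2_prod_summable:
  assumes "u \<in> ell2" "v \<in> ell2"
  shows "(\<lambda>n. u n * cnj (v n)) summable_on UNIV"
  by (rule abs_summable_summable[OF ell2_prod_abs_summable(1)[OF assms]])

lemma ell2_inner_commute: "ell2_inner v u = cnj (ell2_inner u v)"
  by (simp add: ell2_inner_def infsum_cnj [symmetric] mult.commute)

lemma ell2_Cauchy_Schwarz: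
  assumes "u \<in> ell2" "v \<in> ell2"
  shows "cmod (ell2_inner u v) \<le> ell2_norm u * ell2_norm v"
  unfolding ell2_inner_def
  using norm_infsum_bound[OF ell2_prod_abs_summable(1)[OF assms]] ell2_prod_abs_summable(2)[OF assms]
  by linarith

lemma ell2_inner_self:
  assumes "u \<in> ell2"
  shows "ell2_inner u u = of_real ((ell2_norm u)\<^sup>2)"
proof -
  have "(\<lambda>n. u n * cnj (u n)) = (\<lambda>n. of_real ((cmod (u n))\<^sup>2))"
    by (simp add: fun_eq_iff complex_norm_square del: of_real_power)
  thus ?thesis
    unfolding ell2_inner_def ell2_norm_power2
    using assms by (auto intro!: infsumI has_sum_of_real_iff[THEN iffD2] simp: ell2_def simp del: of_real_power)
qed

text \<open>The step size enters the contraction estimate through this expansion.\<close>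

lemma ell2_norm_diff_power2:
  assumes "u \<in> ell2" "v \<in> ell2"
  shows "(ell2_norm (\<lambda>n. u n - of_real t * v n))\<^sup>2
           = (ell2_norm u)\<^sup>2 - 2 * t * Re (ell2_inner u v) + t\<^sup>2 * (ell2_norm v)\<^sup>2"
proof -
  have eq: "(cmod (u n - of_real t * v n))\<^sup>2
      = (cmod (u n))\<^sup>2 + (- 2 * t) * Re (u n * cnj (v n)) + t\<^sup>2 * (cmod (v n))\<^sup>2" for n
    by (simp only: cmod_power2) (simp add: power2_eq_square algebra_simps)
  have "((\<lambda>n. (cmod (u n - of_real t * v n))\<^sup>2) has_sum
      ((ell2_norm u)\<^sup>2 + (- 2 * t) * Re (ell2_inner u v) + t\<^sup>2 * (ell2_norm v)\<^sup>2)) UNIV"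
    unfolding eq ell2_norm_power2 ell2_inner_def
    using assms ell2_prod_summable[OF assms]
    by (intro has_sum_add has_sum_cmult_right has_sum_Re has_sum_infsum) (auto simp: ell2_def)
  thus ?thesis
    unfolding ell2_norm_power2 by (simp add: infsumI ell2_norm_power2)
qed

lemma ell2_finite_support:
  assumes "finite F" "\<And>n. n \<notin> F \<Longrightarrow> u n = 0"
  shows "u \<in> ell2" and "(ell2_norm u)\<^sup>2 = (\<Sum>n\<in>F. (cmod (u n))\<^sup>2)"
proof -
  have "(\<lambda>n. (cmod (u n))\<^sup>2) summable_on F" using assms(1) by simp
  thus "u \<in> ell2"
    unfolding ell2_def mem_Collect_eq
    by (rule summable_on_cong_neutral[THEN iffD1, rotated -1]) (use assms in auto)
  have "(\<Sum>\<^sub>\<infinity>n. (cmod (u n))\<^sup>2) = (\<Sum>\<^sub>\<infinity>n\<in>F. (cmod (u n))\<^sup>2)"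
    by (rule infsum_cong_neutral) (use assms in auto)
  thus "(ell2_norm u)\<^sup>2 = (\<Sum>n\<in>F. (cmod (u n))\<^sup>2)"
    using assms(1) by (simp add: ell2_norm_power2)
qed

lemma ell2_basis_in_ell2: "ell2_basis n \<in> ell2" "ell2_norm (ell2_basis n) = 1"
proof -
  show "ell2_basis n \<in> ell2"
    by (rule ell2_finite_support(1)[of "{n}"]) (auto simp: ell2_basis_def)
  have "(ell2_norm (ell2_basis n))\<^sup>2 = (\<Sum>m\<in>{n}. (cmod (ell2_basis n m))\<^sup>2)"
    by (rule ell2_finite_support(2)) (auto simp: ell2_basis_def)
  hence "(ell2_norm (ell2_basis n))\<^sup>2 = 1"
    by (simp add: ell2_basis_def)
  thus "ell2_norm (ell2_basis n) = 1"
    using ell2_norm_nonneg[of "ell2_basis n"] by (simp add: power2_eq_1_iff)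
qed

lemma ell2_inner_basis: "ell2_inner u (ell2_basis n) = u n"
proof -
  have "ell2_inner u (ell2_basis n) = (\<Sum>\<^sub>\<infinity>m\<in>{n}. u m * cnj (ell2_basis n m))"
    unfolding ell2_inner_def by (rule infsum_cong_neutral) (auto simp: ell2_basis_def)
  thus ?thesis by (simp add: ell2_basis_def)
qed

lemma ell2_truncation_tendsto:
  assumes "u \<in> ell2"
  shows "(\<lambda>L. ell2_norm (\<lambda>n. u n - (if \<bar>n\<bar> \<le> int L then u n else 0))) \<longlonglongrightarrow> 0"
proof (rule LIMSEQ_I)
  fix r :: real assume r: "0 < r"
  let ?f = "\<lambda>n. (cmod (u n))\<^sup>2"
  have s: "?f summable_on UNIV" using assms by (simp add: ell2_def)
  obtain F where F: "finite F" "dist (sum ?f F) (infsum ?f UNIV) \<le> (r/2)\<^sup>2"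
    using infsum_finite_approximation[OF s, of "(r/2)\<^sup>2"] r by auto
  obtain L0 where L0: "\<And>n. n \<in> F \<Longrightarrow> nat \<bar>n\<bar> \<le> L0"
    using finite_nat_set_iff_bounded_le[of "(\<lambda>n. nat \<bar>n\<bar>) ` F"] F(1) by auto
  show "\<exists>no. \<forall>L\<ge>no. norm (ell2_norm (\<lambda>n. u n - (if \<bar>n\<bar> \<le> int L then u n else 0)) - 0) < r"
  proof (intro exI allI impI)
    fix L assume L: "L0 \<le> L"
    let ?v = "\<lambda>n. u n - (if \<bar>n\<bar> \<le> int L then u n else 0)"
    have "L2_set (\<lambda>n. cmod (?v n)) G \<le> r/2" if G: "finite G" for G
    proof -
      have "(\<Sum>n\<in>G. (cmod (?v n))\<^sup>2) = (\<Sum>n\<in>G - F. (cmod (?v n))\<^sup>2)"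
        proof (intro sum.mono_neutral_right ballI)
        fix i assume "i \<in> G - (G - F)"
        hence "nat \<bar>i\<bar> \<le> L0" using L0 by blast
        thus "(cmod (?v i))\<^sup>2 = 0" using L by simp
      qed (use G in auto)
      also have "\<dots> \<le> (\<Sum>n\<in>G - F. ?f n)"
        by (intro sum_mono) auto
      also have "\<dots> = sum ?f (F \<union> G) - sum ?f F"
        using sum.union_disjoint[of F "G - F" ?f] F(1) G by simp
      also have "\<dots> \<le> infsum ?f UNIV - sum ?f F"
        using finite_sum_le_infsum[OF s, of "F \<union> G"] F(1) G by simp
      also have "\<dots> \<le> (r/2)\<^sup>2"
        using F(2) by (simp add: dist_real_def)
      finally show ?thesis
        unfolding L2_set_def using r by (intro real_le_lsqrt) (auto intro: sum_nonneg)
    qed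
    from ell2_if_partial_sums_le(2)[OF this] have "ell2_norm ?v \<le> r/2" .
    thus "norm (ell2_norm ?v - 0) < r"
      using r ell2_norm_nonneg[of ?v] by simp
  qed
qed

text \<open>Completeness, in the only form that an iteration with geometrically decreasing increments requires.
The limit is taken entrywise; bounds on finite partial sums pass to it and give square-summability
as well as convergence in norm.\<close>

lemma ell2_complete_geometric:
  assumes w: "\<And>m. w m \<in> ell2" and q: "0 \<le> q" "q < 1"
    and step: "\<And>m. ell2_norm (\<lambda>n. w (Suc m) n - w m n) \<le> K * q ^ m"
  obtains u where "u \<in> ell2" "(\<lambda>m. ell2_norm (\<lambda>n. w m n - u n)) \<longlonglongrightarrow> 0"
proof -
  have K: "0 \<le> K"
    using step[of 0] ell2_norm_nonneg[of "\<lambda>n. w (Suc 0) n - w 0 n"] by simp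
  have far: "ell2_norm (\<lambda>n. w (m + p) n - w m n) \<le> K * q ^ m * (1 - q ^ p) / (1 - q)" for m p
  proof (induction p)
    case (Suc p)
    have "ell2_norm (\<lambda>n. w (m + Suc p) n - w m n)
        \<le> ell2_norm (\<lambda>n. w (Suc (m + p)) n - w (m + p) n) + ell2_norm (\<lambda>n. w (m + p) n - w m n)"
      using ell2_add(2)[OF ell2_diff(1)[OF w w] ell2_diff(1)[OF w w], of "Suc (m + p)" "m + p" "m + p" m]
      by simp
    also have "\<dots> \<le> K * q ^ (m + p) + K * q ^ m * (1 - q ^ p) / (1 - q)"
      using step Suc by (rule add_mono)
    also have "\<dots> = K * q ^ m * (1 - q ^ Suc p) / (1 - q)"
      using q by (simp add: field_simps power_add)
    finally show ?case .
  qed (simp add: ell2_zero)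
  have far': "ell2_norm (\<lambda>n. w (m + p) n - w m n) \<le> K / (1 - q) * q ^ m" for m p
  proof -
    have "K * q ^ m * (1 - q ^ p) / (1 - q) \<le> K * q ^ m * 1 / (1 - q)"
      using K q by (intro divide_right_mono mult_left_mono) auto
    thus ?thesis using far[of m p] by (simp add: field_simps)
  qed
  have tend0: "(\<lambda>m. K / (1 - q) * q ^ m) \<longlonglongrightarrow> 0"
    using q by (intro tendsto_mult_right_zero LIMSEQ_realpow_zero) auto
  have "convergent (\<lambda>m. w m n)" for n
  proof (rule Cauchy_convergent, rule CauchyI')
    fix e :: real assume "0 < e"
    then obtain M where M: "\<And>m. m \<ge> M \<Longrightarrow> K / (1 - q) * q ^ m < e"
      using order_tendstoD(2)[OF tend0, of e] by (auto simp: eventually_sequentially)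
    have "dist (w m n) (w m' n) < e" if "m \<ge> M" "m' > m" for m m'
    proof -
      obtain p where p: "m' = m + p" using \<open>m' > m\<close> less_imp_add_positive by blast
      have "dist (w m n) (w m' n) = cmod (w (m + p) n - w m n)"
        by (simp add: dist_norm norm_minus_commute p)
      also have "\<dots> \<le> ell2_norm (\<lambda>n. w (m + p) n - w m n)"
        by (rule norm_le_ell2_norm[OF ell2_diff(1)[OF w w]])
      also have "\<dots> < e" using far'[where m = m and p = p] M[OF that(1)] by linarith
      finally show ?thesis .
    qed
    thus "\<exists>M. \<forall>m\<ge>M. \<forall>n'>m. dist (w m n) (w n' n) < e" by blast
  qed
  then obtain u where u: "\<And>n. (\<lambda>m. w m n) \<longlonglongrightarrow> u n"
    unfolding convergent_def by metis
  have "L2_set (\<lambda>n. cmod (u n - w m n)) F \<le> K / (1 - q) * q ^ m" if F: "finite F" for m F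
  proof (rule LIMSEQ_le_const2)
    show "(\<lambda>p. L2_set (\<lambda>n. cmod (w (p + m) n - w m n)) F) \<longlonglongrightarrow> L2_set (\<lambda>n. cmod (u n - w m n)) F"
      unfolding L2_set_def by (intro tendsto_intros LIMSEQ_ignore_initial_segment u)
    show "\<exists>N. \<forall>p\<ge>N. L2_set (\<lambda>n. cmod (w (p + m) n - w m n)) F \<le> K / (1 - q) * q ^ m"
    proof (intro exI allI impI)
      fix p
      have "L2_set (\<lambda>n. cmod (w (p + m) n - w m n)) F \<le> ell2_norm (\<lambda>n. w (m + p) n - w m n)"
        using ell2_partial_sum_le[OF ell2_diff(1)[OF w w] F] by (simp add: add.commute)
      also have "\<dots> \<le> K / (1 - q) * q ^ m" by (rule far')
      finally show "L2_set (\<lambda>n. cmod (w (p + m) n - w m n)) F \<le> K / (1 - q) * q ^ m" .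
    qed
  qed
  hence d: "(\<lambda>n. u n - w m n) \<in> ell2" "ell2_norm (\<lambda>n. u n - w m n) \<le> K / (1 - q) * q ^ m" for m
    using ell2_if_partial_sums_le[of "\<lambda>n. u n - w m n" "K / (1 - q) * q ^ m"] by blast+
  show thesis
  proof
    show "u \<in> ell2"
      using ell2_add(1)[OF d(1)[of 0] w[of 0]] by simp
    show "(\<lambda>m. ell2_norm (\<lambda>n. w m n - u n)) \<longlonglongrightarrow> 0"
      by (rule tendsto_sandwich[OF _ _ tendsto_const tend0])
         (use d(2) in \<open>auto simp: ell2_norm_nonneg ell2_norm_diff_commute[of _ u]\<close>)
  qed
qed

section \<open>Exponentials of the phase, and gradient descent\<close>

definition unit_exp :: "real \<Rightarrow> complex" where
  "unit_exp t = cis (2 * pi * t)"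

lemma unit_exp_add: "unit_exp (s + t) = unit_exp s * unit_exp t"
  by (simp add: unit_exp_def cis_mult distrib_left)

lemma unit_exp_of_int: "unit_exp (of_int k) = 1"
  by (simp add: unit_exp_def cis_multiple_2pi)

lemma unit_exp_0: "unit_exp 0 = 1"
  by (simp add: unit_exp_def)

lemma norm_unit_exp: "cmod (unit_exp t) = 1"
  by (simp add: unit_exp_def)

lemma unit_exp_nonzero: "unit_exp t \<noteq> 0"
  using norm_unit_exp[of t] by auto

lemma cnj_unit_exp: "cnj (unit_exp t) = unit_exp (- t)"
  by (simp add: unit_exp_def cis_cnj)

lemma continuous_on_unit_exp [continuous_intros]:
  "continuous_on S f \<Longrightarrow> continuous_on S (\<lambda>x. unit_exp (f x))"
  unfolding unit_exp_def by (intro continuous_intros)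

text \<open>With \<open>S\<close> the adjoint of \<open>T\<close>, this is gradient descent with step size \<open>t\<close> for minimising
\<open>\<parallel>T u - v\<parallel>\<^sup>2\<close>, started at \<open>0\<close>. The residual \<open>v - T u\<close> obeys a recursion of its own, and the
approximate solutions accumulate its images under \<open>S\<close>. The index type is left open because the same iteration
is run on \<open>\<int>\<close> and on \<open>\<int>\<^sup>2\<close>.\<close>

primrec residual ::
    "(('a \<Rightarrow> complex) \<Rightarrow> 'a \<Rightarrow> complex) \<Rightarrow> (('a \<Rightarrow> complex) \<Rightarrow> 'a \<Rightarrow> complex) \<Rightarrow>
     real \<Rightarrow> ('a \<Rightarrow> complex) \<Rightarrow> nat \<Rightarrow> 'a \<Rightarrow> complex" where
  "residual T S t v 0 = v"
| "residual T S t v (Suc m)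
     = (\<lambda>n. residual T S t v m n - of_real t * T (S (residual T S t v m)) n)"

primrec approximant ::
    "(('a \<Rightarrow> complex) \<Rightarrow> 'a \<Rightarrow> complex) \<Rightarrow> (('a \<Rightarrow> complex) \<Rightarrow> 'a \<Rightarrow> complex) \<Rightarrow>
     real \<Rightarrow> ('a \<Rightarrow> complex) \<Rightarrow> nat \<Rightarrow> 'a \<Rightarrow> complex" where
  "approximant T S t v 0 = (\<lambda>n. 0)"
| "approximant T S t v (Suc m)
     = (\<lambda>n. approximant T S t v m n + of_real t * S (residual T S t v m) n)"

lemma has_sum_finite_sum:
  fixes f :: "'i \<Rightarrow> 'a \<Rightarrow> complex"
  assumes "\<And>i. (f i has_sum s i) A" "finite I"
  shows "((\<lambda>n. \<Sum>i\<in>I. f i n) has_sum (\<Sum>i\<in>I. s i)) A"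
  using assms(2) by (induction I rule: finite_induct) (auto intro: has_sum_add assms(1))

section \<open>The operators of a symbol\<close>

locale rotation_algebra =
  fixes \<alpha> :: real and D :: nat
begin

definition box :: "(int \<times> int) set" where
  "box = {- int D..int D} \<times> {- int D..int D}"

text \<open>A symbol \<open>a\<close> stands for the finite sum of the terms \<open>a (k, j) * e (j * x)\<close> followed by a shift by
\<open>k\<close>. The box makes the sum finite and is invariant under quarter turns.\<close>

definition fiber_op ::
    "(int \<times> int \<Rightarrow> complex) \<Rightarrow> real \<Rightarrow> (int \<Rightarrow> complex) \<Rightarrow> int \<Rightarrow> complex" where
  "fiber_op a x u n =
     (\<Sum>p\<in>box. a p * unit_exp (of_int (snd p) * (x + of_int n * \<alpha>)) * u (n + fst p))"

text \<open>Moving the shift of a term past its multiplication operator produces the phase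
\<open>e (k * j * \<alpha>)\<close>.\<close>

definition adjoint_symbol :: "(int \<times> int \<Rightarrow> complex) \<Rightarrow> int \<times> int \<Rightarrow> complex" where
  "adjoint_symbol a p = cnj (a (- p)) * unit_exp (of_int (fst p) * of_int (snd p) * \<alpha>)"

definition symbol_norm :: "(int \<times> int \<Rightarrow> complex) \<Rightarrow> real" where
  "symbol_norm a = (\<Sum>p\<in>box. cmod (a p))"

lemma finite_box: "finite box"
  by (simp add: box_def)

lemma bij_uminus_box: "bij_betw uminus box box"
  by (rule bij_betwI[where g = uminus]) (auto simp: box_def)

lemma symbol_norm_adjoint: "symbol_norm (adjoint_symbol a) = symbol_norm a"
  unfolding symbol_norm_def
  using sum.reindex_bij_betw[OF bij_uminus_box, of "\<lambda>p. cmod (a p)"]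
  by (simp add: adjoint_symbol_def norm_mult norm_unit_exp)

lemma fiber_op_term:
  assumes "u \<in> ell2"
  shows "(\<lambda>n. a p * unit_exp (of_int (snd p) * (x + of_int n * \<alpha>)) * u (n + fst p)) \<in> ell2"
    and "ell2_norm (\<lambda>n. a p * unit_exp (of_int (snd p) * (x + of_int n * \<alpha>)) * u (n + fst p))
           = cmod (a p) * ell2_norm u"
  using ell2_weighted_shift[OF assms,
      of "\<lambda>n. a p * unit_exp (of_int (snd p) * (x + of_int n * \<alpha>))" "cmod (a p)" "fst p"]
  by (simp_all add: norm_mult norm_unit_exp)

lemma fiber_op_ell2:
  assumes "u \<in> ell2"
  shows "fiber_op a x u \<in> ell2"
    and "ell2_norm (fiber_op a x u) \<le> symbol_norm a * ell2_norm u"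
proof -
  note sum = ell2_sum[where f = "\<lambda>p n. a p * unit_exp (of_int (snd p) * (x + of_int n * \<alpha>)) * u (n + fst p)",
      OF finite_box fiber_op_term(1)[OF assms, where a = a and x = x]]
  show "fiber_op a x u \<in> ell2"
    using sum(1) by (simp add: fiber_op_def [abs_def])
  show "ell2_norm (fiber_op a x u) \<le> symbol_norm a * ell2_norm u"
    using sum(2) by (simp add: fiber_op_def [abs_def] fiber_op_term(2)[OF assms] symbol_norm_def sum_distrib_right)
qed

lemma fiber_op_linear: "fiber_op a x (\<lambda>n. u n + c * v n) n = fiber_op a x u n + c * fiber_op a x v n"
  by (simp add: fiber_op_def sum_distrib_left sum.distrib algebra_simps)

lemma fiber_op_diff: "fiber_op a x (\<lambda>n. u n - v n) = (\<lambda>n. fiber_op a x u n - fiber_op a x v n)"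
  using fiber_op_linear[of a x u "-1" v] by (simp add: fun_eq_iff)

text \<open>With \<open>n + k\<close> as new summation variable, the term with index \<open>(k, j)\<close> becomes the term of the adjoint
symbol with index \<open>(- k, - j)\<close>.\<close>

lemma fiber_op_adjoint:
  assumes u: "u \<in> ell2" and v: "v \<in> ell2"
  shows "ell2_inner (fiber_op a x u) v = ell2_inner u (fiber_op (adjoint_symbol a) x v)"
proof -
  define f where "f p n = a p * unit_exp (of_int (snd p) * (x + of_int n * \<alpha>)) * u (n + fst p) * cnj (v n)" for p n
  define g where "g p n = u n * cnj (adjoint_symbol a p * unit_exp (of_int (snd p) * (x + of_int n * \<alpha>)) * v (n + fst p))" for p n
  have "(f p has_sum infsum (f p) UNIV) UNIV" for p
    using ell2_prod_summable[OF fiber_op_term(1)[OF u, of a p x] v] unfolding f_def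
    by (rule has_sum_infsum)
  hence "((\<lambda>n. \<Sum>p\<in>box. f p n) has_sum (\<Sum>p\<in>box. infsum (f p) UNIV)) UNIV"
    using finite_box by (rule has_sum_finite_sum)
  hence 1: "ell2_inner (fiber_op a x u) v = (\<Sum>p\<in>box. infsum (f p) UNIV)"
    by (simp add: ell2_inner_def fiber_op_def sum_distrib_right f_def infsumI)
  have "(g p has_sum infsum (g p) UNIV) UNIV" for p
    using ell2_prod_summable[OF u fiber_op_term(1)[OF v, of "adjoint_symbol a" p x]] unfolding g_def
    by (rule has_sum_infsum)
  hence "((\<lambda>n. \<Sum>p\<in>box. g p n) has_sum (\<Sum>p\<in>box. infsum (g p) UNIV)) UNIV"
    using finite_box by (rule has_sum_finite_sum)
  hence 2: "ell2_inner u (fiber_op (adjoint_symbol a) x v) = (\<Sum>p\<in>box. infsum (g p) UNIV)"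
    by (simp add: ell2_inner_def fiber_op_def sum_distrib_left cnj_sum g_def infsumI)
  have "infsum (f p) UNIV = infsum (g (- p)) UNIV" for p
  proof -
    have "f p n = g (- p) (n + fst p)" for n
      by (simp add: f_def g_def adjoint_symbol_def cnj_unit_exp mult.assoc
            unit_exp_add [symmetric] algebra_simps)
    hence "infsum (f p) UNIV = (\<Sum>\<^sub>\<infinity>n. g (- p) (n + fst p))"
      by (intro infsum_cong)
    thus ?thesis using infsum_reindex_bij_betw[OF bij_int_shift, of "g (- p)"] by simp
  qed
  thus ?thesis
    unfolding 1 2 using sum.reindex_bij_betw[OF bij_uminus_box, of "\<lambda>p. infsum (g p) UNIV"] by simp
qed

text \<open>The bound is required on finitely supported sequences only, where squared norms are finite sums that depend
continuously on the phase and can be integrated over it term by term.\<close>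

definition bounded_below :: "real \<Rightarrow> (int \<times> int \<Rightarrow> complex) \<Rightarrow> bool" where
  "bounded_below C a \<longleftrightarrow>
     (\<forall>x u. finite {n. u n \<noteq> 0} \<longrightarrow> ell2_norm u \<le> C * ell2_norm (fiber_op a x u))"

text \<open>A square-summable sequence is the limit of its truncations, and the operator is continuous.\<close>

lemma bounded_below_ell2:
  assumes "bounded_below C a" "0 \<le> C" "u \<in> ell2"
  shows "ell2_norm u \<le> C * ell2_norm (fiber_op a x u)"
proof -
  define v where "v L n = (if \<bar>n\<bar> \<le> int L then u n else 0)" for L :: nat and n :: int
  define d where "d L = ell2_norm (\<lambda>n. u n - v L n)" for L
  have fin: "finite {n. v L n \<noteq> 0}" for L
    by (rule finite_subset[of _ "{- int L..int L}"]) (auto simp: v_def split: if_splits)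
  have v: "v L \<in> ell2" for L
    using ell2_finite_support(1)[OF fin[of L]] by simp
  have "ell2_norm u \<le> C * ell2_norm (fiber_op a x u) + (1 + C * symbol_norm a) * d L" for L
  proof -
    have "ell2_norm (fiber_op a x (v L))
        \<le> ell2_norm (fiber_op a x u) + ell2_norm (fiber_op a x (\<lambda>n. u n - v L n))"
      using ell2_diff(2)[OF fiber_op_ell2(1)[OF assms(3)] fiber_op_ell2(1)[OF ell2_diff(1)[OF assms(3) v[of L]]], of a x a x]
      by (simp add: fiber_op_diff)
    also have "\<dots> \<le> ell2_norm (fiber_op a x u) + symbol_norm a * d L"
      unfolding d_def by (intro add_left_mono fiber_op_ell2(2)[OF ell2_diff(1)[OF assms(3) v]])
    finally have *: "C * ell2_norm (fiber_op a x (v L)) \<le> C * (ell2_norm (fiber_op a x u) + symbol_norm a * d L)"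
      using assms(2) by (rule mult_left_mono)
    have "ell2_norm u \<le> d L + ell2_norm (v L)"
      using ell2_add(2)[OF ell2_diff(1)[OF assms(3) v[of L]] v[of L]] by (simp add: d_def)
    moreover have "ell2_norm (v L) \<le> C * ell2_norm (fiber_op a x (v L))"
      using assms(1) fin by (simp add: bounded_below_def)
    ultimately show ?thesis
      using * by (simp add: algebra_simps)
  qed
  moreover have "(\<lambda>L. C * ell2_norm (fiber_op a x u) + (1 + C * symbol_norm a) * d L)
      \<longlonglongrightarrow> C * ell2_norm (fiber_op a x u) + (1 + C * symbol_norm a) * 0"
    using ell2_truncation_tendsto[OF assms(3)] unfolding d_def v_def by (intro tendsto_intros)
  ultimately show ?thesis
    by (intro LIMSEQ_le_const) auto
qed

end

section \<open>Inverting an operator that is bounded below with its adjoint\<close>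

text \<open>The constants are parameters so that a symbol and its dual can be treated with one step size \<open>t\<close>.
The bound on \<open>t\<close> makes the quadratic term of the contraction estimate at most half of the linear
one.\<close>

locale invertible_symbol = rotation_algebra +
  fixes a :: "int \<times> int \<Rightarrow> complex" and C M t :: real
  assumes C: "1 \<le> C" and M: "1 \<le> M" and norm_le: "symbol_norm a \<le> M"
    and below: "bounded_below C a" and adjoint_below: "bounded_below C (adjoint_symbol a)"
    and t_pos: "0 < t" and t_small: "t * M ^ 4 * C\<^sup>2 \<le> 1"
begin

abbreviation T :: "real \<Rightarrow> (int \<Rightarrow> complex) \<Rightarrow> int \<Rightarrow> complex" where "T x \<equiv> fiber_op a x"
abbreviation S :: "real \<Rightarrow> (int \<Rightarrow> complex) \<Rightarrow> int \<Rightarrow> complex" where "S x \<equiv> fiber_op (adjoint_symbol a) x"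

definition q :: real where "q = sqrt (1 - t / C\<^sup>2)"

lemma t_le: "t / C\<^sup>2 \<le> 1"
proof -
  have "t / C\<^sup>2 \<le> t" using C t_pos by (simp add: divide_le_eq)
  also have "t \<le> t * (M ^ 4 * C\<^sup>2)"
    using C M t_pos mult_mono[of 1 "M ^ 4" 1 "C\<^sup>2"] by (simp add: one_le_power)
  finally show ?thesis using t_small by (simp add: mult.assoc)
qed

lemma q_bounds: "0 \<le> q" "q < 1"
  using t_le t_pos C by (auto simp: q_def)

lemma T_bound: "u \<in> ell2 \<Longrightarrow> ell2_norm (T x u) \<le> M * ell2_norm u"
  using fiber_op_ell2(2)[of u a x] norm_le mult_right_mono[OF norm_le ell2_norm_nonneg[of u]] by linarith

lemma S_bound: "u \<in> ell2 \<Longrightarrow> ell2_norm (S x u) \<le> M * ell2_norm u"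
  using fiber_op_ell2(2)[of u "adjoint_symbol a" x] mult_right_mono[OF norm_le ell2_norm_nonneg[of u]]
  by (simp add: symbol_norm_adjoint)

text \<open>The first-order term of \<open>\<parallel>u - t T S u\<parallel>\<^sup>2\<close> is \<open>- 2 t \<parallel>S u\<parallel>\<^sup>2\<close>, which the lower bound for the adjoint
makes at most \<open>- 2 t \<parallel>u\<parallel>\<^sup>2 / C\<^sup>2\<close>. The second-order term is at most \<open>t\<^sup>2 M\<^sup>4 \<parallel>u\<parallel>\<^sup>2\<close>, and the bound on
\<open>t\<close> lets it cancel no more than half of this.\<close>

lemma contraction:
  assumes u: "u \<in> ell2"
  shows "ell2_norm (\<lambda>n. u n - of_real t * T x (S x u) n) \<le> q * ell2_norm u"
proof -
  let ?U = "(ell2_norm u)\<^sup>2"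
  have Su: "S x u \<in> ell2" and TSu: "T x (S x u) \<in> ell2"
    using u by (intro fiber_op_ell2(1); simp)+
  have "ell2_inner (T x (S x u)) u = of_real ((ell2_norm (S x u))\<^sup>2)"
    using fiber_op_adjoint[OF Su u] ell2_inner_self[OF Su] by simp
  hence re: "Re (ell2_inner u (T x (S x u))) = (ell2_norm (S x u))\<^sup>2"
    by (subst ell2_inner_commute) (simp del: of_real_power)
  have "ell2_norm u \<le> C * ell2_norm (S x u)"
    using bounded_below_ell2[OF adjoint_below _ u] C by simp
  hence "?U \<le> (C * ell2_norm (S x u))\<^sup>2"
    by (intro power_mono ell2_norm_nonneg)
  hence lower: "?U / C\<^sup>2 \<le> (ell2_norm (S x u))\<^sup>2"
    using C by (simp add: power_mult_distrib divide_le_eq mult.commute)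
  have "ell2_norm (T x (S x u)) \<le> M * (M * ell2_norm u)"
    using M by (intro order_trans[OF T_bound[OF Su]] mult_left_mono S_bound[OF u]) auto
  hence "(ell2_norm (T x (S x u)))\<^sup>2 \<le> (M * (M * ell2_norm u))\<^sup>2"
    by (intro power_mono ell2_norm_nonneg)
  also have "\<dots> = M ^ 4 * ?U"
    by (simp add: power_mult_distrib power2_eq_square power4_eq_xxxx)
  finally have "t\<^sup>2 * (ell2_norm (T x (S x u)))\<^sup>2 \<le> t\<^sup>2 * (M ^ 4 * ?U)"
    by (intro mult_left_mono) auto
  also have "\<dots> = (t * M ^ 4 * C\<^sup>2) * (t * (?U / C\<^sup>2))"
    using C by (simp add: power2_eq_square)
  also have "\<dots> \<le> 1 * (t * (?U / C\<^sup>2))"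
    using t_small t_pos by (intro mult_right_mono) auto
  finally have upper: "t\<^sup>2 * (ell2_norm (T x (S x u)))\<^sup>2 \<le> t * (?U / C\<^sup>2)" by simp
  have "(ell2_norm (\<lambda>n. u n - of_real t * T x (S x u) n))\<^sup>2
      \<le> ?U - 2 * (t * (?U / C\<^sup>2)) + t * (?U / C\<^sup>2)"
  proof -
    have "U - 2 * A + E \<le> U - 2 * B + B" if "E \<le> B" "B \<le> A" for U A B E :: real
      using that by simp
    from this[OF upper mult_left_mono[OF lower less_imp_le[OF t_pos]]] show ?thesis
      unfolding ell2_norm_diff_power2[OF u TSu] re by (simp only: mult.assoc)
  qed
  also have "\<dots> = (q * ell2_norm u)\<^sup>2"
    using t_le by (simp add: q_def power_mult_distrib algebra_simps)
  finally show ?thesis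
    by (rule power2_le_imp_le) (rule mult_nonneg_nonneg[OF q_bounds(1) ell2_norm_nonneg])
qed

lemma residual_ell2:
  assumes "v \<in> ell2"
  shows "residual (T x) (S x) t v m \<in> ell2"
    and "ell2_norm (residual (T x) (S x) t v m) \<le> q ^ m * ell2_norm v"
proof -
  have "residual (T x) (S x) t v m \<in> ell2 \<and> ell2_norm (residual (T x) (S x) t v m) \<le> q ^ m * ell2_norm v"
  proof (induction m)
    case (Suc m)
    let ?r = "residual (T x) (S x) t v m"
    have "ell2_norm (\<lambda>n. ?r n - of_real t * T x (S x ?r) n) \<le> q * ell2_norm ?r"
      using Suc contraction by blast
    also have "\<dots> \<le> q * (q ^ m * ell2_norm v)"
      using Suc q_bounds(1) by (intro mult_left_mono) auto
    finally show ?case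
      using Suc by (auto simp: mult.assoc intro!: ell2_diff(1) ell2_scale(1) fiber_op_ell2(1))
  qed (use assms in auto)
  thus "residual (T x) (S x) t v m \<in> ell2"
    and "ell2_norm (residual (T x) (S x) t v m) \<le> q ^ m * ell2_norm v" by auto
qed

lemma approximant_ell2:
  assumes "v \<in> ell2"
  shows "approximant (T x) (S x) t v m \<in> ell2"
  by (induction m)
     (auto simp: ell2_zero intro!: ell2_add(1) ell2_scale(1) fiber_op_ell2(1) residual_ell2(1) assms)

lemma T_approximant:
  "T x (approximant (T x) (S x) t v m) = (\<lambda>n. v n - residual (T x) (S x) t v m n)"
proof (induction m)
  case 0
  show ?case by (simp add: fiber_op_def fun_eq_iff)
next
  case (Suc m)
  thus ?case by (simp add: fiber_op_linear fun_eq_iff)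
qed

text \<open>The approximate solutions converge, and the residuals tend to \<open>0\<close>.\<close>

lemma T_surj:
  assumes v: "v \<in> ell2"
  shows "\<exists>u\<in>ell2. T x u = v"
proof -
  let ?r = "residual (T x) (S x) t v" and ?w = "approximant (T x) (S x) t v"
  have "ell2_norm (\<lambda>n. ?w (Suc m) n - ?w m n) \<le> t * M * ell2_norm v * q ^ m" for m
  proof -
    have "ell2_norm (\<lambda>n. ?w (Suc m) n - ?w m n) = t * ell2_norm (S x (?r m))"
      using ell2_scale(2)[OF fiber_op_ell2(1)[OF residual_ell2(1)[OF v]], of "of_real t"] t_pos by simp
    also have "\<dots> \<le> t * (M * (q ^ m * ell2_norm v))"
      using t_pos M
      by (intro mult_left_mono order_trans[OF S_bound[OF residual_ell2(1)[OF v]]] residual_ell2(2)[OF v]) auto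
    finally show ?thesis by (simp add: mult_ac)
  qed
  note step = this
  obtain u where u: "u \<in> ell2" and lim: "(\<lambda>m. ell2_norm (\<lambda>n. ?w m n - u n)) \<longlonglongrightarrow> 0"
    by (rule ell2_complete_geometric[OF approximant_ell2[OF v] q_bounds step])
  have "ell2_norm (\<lambda>n. T x u n - v n) \<le> M * ell2_norm (\<lambda>n. ?w m n - u n) + q ^ m * ell2_norm v" for m
  proof -
    have d: "(\<lambda>n. u n - ?w m n) \<in> ell2" using u approximant_ell2[OF v] by (rule ell2_diff(1))
    have eq: "(\<lambda>n. T x u n - v n) = (\<lambda>n. T x (\<lambda>n. u n - ?w m n) n - ?r m n)"
      by (simp add: fiber_op_diff T_approximant)
    show ?thesis
      unfolding eq ell2_norm_diff_commute[of "?w m"]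
      by (rule order_trans[OF ell2_diff(2)[OF fiber_op_ell2(1)[OF d] residual_ell2(1)[OF v]]
            add_mono[OF T_bound[OF d] residual_ell2(2)[OF v]]])
  qed
  moreover have "(\<lambda>m. M * ell2_norm (\<lambda>n. ?w m n - u n) + q ^ m * ell2_norm v) \<longlonglongrightarrow> M * 0 + 0 * ell2_norm v"
    using q_bounds by (intro tendsto_intros lim LIMSEQ_realpow_zero) auto
  ultimately have "ell2_norm (\<lambda>n. T x u n - v n) \<le> 0"
    by (intro LIMSEQ_le_const) auto
  hence "T x u = v"
    using ell2_norm_diff_le_zero_imp_eq[OF fiber_op_ell2(1)[OF u] v] by simp
  thus ?thesis using u by blast
qed

lemma T_bounded_below: "u \<in> ell2 \<Longrightarrow> ell2_norm u \<le> C * ell2_norm (T x u)"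
  using bounded_below_ell2[OF below] C by simp

lemma T_bij: "bij_betw (T x) ell2 ell2"
  unfolding bij_betw_def
proof
  show "inj_on (T x) ell2"
  proof (rule inj_onI)
    fix u v assume u: "u \<in> ell2" and v: "v \<in> ell2" and eq: "T x u = T x v"
    have "ell2_norm (\<lambda>n. u n - v n) \<le> C * ell2_norm (\<lambda>n. T x u n - T x v n)"
      using T_bounded_below[OF ell2_diff(1)[OF u v]] by (simp add: fiber_op_diff)
    hence "ell2_norm (\<lambda>n. u n - v n) \<le> 0"
      by (simp add: eq ell2_zero)
    thus "u = v"
      using ell2_norm_diff_le_zero_imp_eq[OF u v] by simp
  qed
  show "T x ` ell2 = ell2"
  proof
    show "T x ` ell2 \<subseteq> ell2" by (auto intro: fiber_op_ell2(1))
    show "ell2 \<subseteq> T x ` ell2" using T_surj by (metis imageI subsetI)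
  qed
qed

text \<open>The lower bound for \<open>T x\<close> turns the decay of the residual into an error bound that is uniform in the
phase \<open>x\<close>.\<close>

lemma approximant_error:
  assumes "v \<in> ell2"
  shows "cmod (approximant (T x) (S x) t v m n - inv_into ell2 (T x) v n) \<le> C * (q ^ m * ell2_norm v)"
proof -
  let ?g = "inv_into ell2 (T x) v"
  have img: "v \<in> T x ` ell2" using assms T_bij by (simp add: bij_betw_def)
  have g: "?g \<in> ell2" "T x ?g = v"
    using inv_into_into[OF img] f_inv_into_f[OF img] by auto
  have d: "(\<lambda>n. ?g n - approximant (T x) (S x) t v m n) \<in> ell2"
    using g(1) approximant_ell2[OF assms] by (rule ell2_diff(1))
  have "cmod (?g n - approximant (T x) (S x) t v m n)
      \<le> C * ell2_norm (T x (\<lambda>n. ?g n - approximant (T x) (S x) t v m n))"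
    using norm_le_ell2_norm[OF d] T_bounded_below[OF d] order_trans by blast
  also have "\<dots> = C * ell2_norm (residual (T x) (S x) t v m)"
    by (simp add: fiber_op_diff T_approximant g(2))
  also have "\<dots> \<le> C * (q ^ m * ell2_norm v)"
    using residual_ell2(2)[OF assms] C by (intro mult_left_mono) auto
  finally show ?thesis by (simp add: norm_minus_commute)
qed

end

section \<open>Finitely supported functions on the square lattice and their fibers\<close>

definition lattice_basis :: "int \<Rightarrow> int \<times> int \<Rightarrow> complex" where
  "lattice_basis n p = (if p = (n, 0) then 1 else 0)"

definition lattice_sq :: "(int \<times> int \<Rightarrow> complex) \<Rightarrow> real" where
  "lattice_sq u = (\<Sum>p | u p \<noteq> 0. (cmod (u p))\<^sup>2)"

text \<open>The second variable is the Fourier variable of the phase: a function on \<open>\<int>\<^sup>2\<close> is a trigonometric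
polynomial in \<open>x\<close> with values in the sequences on \<open>\<int>\<close>. The infinite sum avoids a choice of a
finite range of summation.\<close>

definition fiber :: "real \<Rightarrow> (int \<times> int \<Rightarrow> complex) \<Rightarrow> int \<Rightarrow> complex" where
  "fiber x u n = (\<Sum>\<^sub>\<infinity>l. u (n, l) * unit_exp (of_int l * x))"

lemma lattice_sq_eq:
  assumes "finite F" "\<And>p. p \<notin> F \<Longrightarrow> u p = 0"
  shows "lattice_sq u = (\<Sum>p\<in>F. (cmod (u p))\<^sup>2)"
  unfolding lattice_sq_def using assms by (intro sum.mono_neutral_left) auto

lemma finite_row:
  assumes "finite {p. u p \<noteq> (0::complex)}"
  shows "finite {l. u (n, l) * f l \<noteq> 0}"
proof (rule finite_subset)
  show "{l. u (n, l) * f l \<noteq> 0} \<subseteq> snd ` {p. u p \<noteq> 0}" by force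
qed (use assms in simp)

lemma fiber_summable:
  fixes f :: "int \<Rightarrow> complex"
  assumes "finite {p. u p \<noteq> (0::complex)}"
  shows "(\<lambda>l. u (n, l) * f l) summable_on UNIV"
  by (rule finite_nonzero_values_imp_summable_on) (use finite_row[OF assms, of n f] in simp)

lemma fiber_eq_sum:
  assumes "finite A" "\<And>n l. l \<notin> A \<Longrightarrow> u (n, l) = 0"
  shows "fiber x u n = (\<Sum>l\<in>A. u (n, l) * unit_exp (of_int l * x))"
proof -
  have "fiber x u n = (\<Sum>\<^sub>\<infinity>l\<in>A. u (n, l) * unit_exp (of_int l * x))"
    unfolding fiber_def by (rule infsum_cong_neutral) (use assms in auto)
  thus ?thesis using assms(1) by simp
qed

lemma fiber_linear:
  assumes "finite {p. u p \<noteq> 0}" "finite {p. v p \<noteq> 0}"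
  shows "fiber x (\<lambda>p. u p + c * v p) n = fiber x u n + c * fiber x v n"
proof -
  have "fiber x (\<lambda>p. u p + c * v p) n
      = (\<Sum>\<^sub>\<infinity>l. u (n, l) * unit_exp (of_int l * x) + c * (v (n, l) * unit_exp (of_int l * x)))"
    by (simp add: fiber_def algebra_simps)
  also have "\<dots> = fiber x u n + c * fiber x v n"
    unfolding fiber_def using fiber_summable[OF assms(1)] fiber_summable[OF assms(2)]
    by (subst infsum_add) (auto intro: summable_on_cmult_right simp: infsum_cmult_right')
  finally show ?thesis .
qed

lemma finite_support_linear:
  assumes "finite {p. u p \<noteq> (0::complex)}" "finite {p. v p \<noteq> 0}"
  shows "finite {p. u p + c * v p \<noteq> 0}"
  by (rule finite_subset[OF _ finite_UnI[OF assms]]) auto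

lemma finite_support_fiber:
  assumes "finite {p. u p \<noteq> 0}"
  shows "finite {n. fiber x u n \<noteq> 0}"
proof (rule finite_subset)
  have "fiber x u n = 0" if "n \<notin> fst ` {p. u p \<noteq> 0}" for n
  proof -
    have "u (n, l) = 0" for l using that by force
    thus ?thesis by (simp add: fiber_def)
  qed
  thus "{n. fiber x u n \<noteq> 0} \<subseteq> fst ` {p. u p \<noteq> 0}" by blast
qed (use assms in simp)

lemma finite_support_lattice_basis: "finite {p. lattice_basis n p \<noteq> 0}"
  by (rule finite_subset[of _ "{(n, 0)}"]) (auto simp: lattice_basis_def)

lemma fiber_lattice_basis: "fiber x (lattice_basis n) = ell2_basis n"
proof
  fix m
  have "fiber x (lattice_basis n) m = (\<Sum>l\<in>{0}. lattice_basis n (m, l) * unit_exp (of_int l * x))"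
    by (rule fiber_eq_sum) (auto simp: lattice_basis_def)
  thus "fiber x (lattice_basis n) m = ell2_basis n m"
    by (simp add: lattice_basis_def ell2_basis_def unit_exp_0)
qed

lemma has_integral_unit_exp:
  "((\<lambda>x. unit_exp (of_int l * x)) has_integral (if l = 0 then 1 else 0)) {0..1}"
proof (cases "l = 0")
  case True
  thus ?thesis
    using has_integral_const_real[of "1::complex" 0 1] by (simp add: unit_exp_0)
next
  case False
  define w :: complex where "w = 2 * of_real pi * \<i> * of_int l"
  have w: "w \<noteq> 0" using False by (simp add: w_def)
  have eq: "unit_exp (of_int l * x) = exp (w * of_real x)" for x
    by (simp add: unit_exp_def cis_conv_exp w_def mult_ac)
  have "((\<lambda>x. exp (w * of_real x)) has_integral
      (exp (w * of_real 1) / w - exp (w * of_real 0) / w)) {0..1}"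
    by (rule fundamental_theorem_of_calculus)
       (auto intro!: derivative_eq_intros has_vector_derivative_real_field simp: w)
  moreover have "exp (w * of_real 1) = 1"
    using eq[of 1] unit_exp_of_int[of l] by simp
  ultimately show ?thesis using False by (simp add: eq)
qed

lemma integral_fiber:
  assumes "finite {p. u p \<noteq> 0}"
  shows "((\<lambda>x. fiber x u n) has_integral u (n, 0)) {0..1}"
proof -
  let ?A = "insert 0 (snd ` {p. u p \<noteq> 0})"
  have fin: "finite ?A" using assms by simp
  have "fiber x u n = (\<Sum>l\<in>?A. u (n, l) * unit_exp (of_int l * x))" for x
    by (rule fiber_eq_sum[OF fin]) force
  moreover have "((\<lambda>x. \<Sum>l\<in>?A. u (n, l) * unit_exp (of_int l * x)) has_integral
      (\<Sum>l\<in>?A. u (n, l) * (if l = 0 then 1 else 0))) {0..1}"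
    by (intro has_integral_sum fin has_integral_mult_right has_integral_unit_exp)
  moreover have "(\<Sum>l\<in>?A. u (n, l) * (if l = 0 then 1 else 0)) = u (n, 0)"
    using fin by (simp add: if_distrib[of "\<lambda>c. _ * c"] cong: if_cong)
  ultimately show ?thesis by simp
qed

text \<open>Expanding the square leaves the integrals of \<open>e ((l - k) * x)\<close>, of which only the diagonal ones are
nonzero.\<close>

lemma trig_Parseval:
  assumes "finite A"
  shows "((\<lambda>x. (cmod (\<Sum>l\<in>A. c l * unit_exp (of_int l * x)))\<^sup>2) has_integral
           (\<Sum>l\<in>A. (cmod (c l))\<^sup>2)) {0..1}"
proof -
  have eq: "of_real ((cmod (\<Sum>l\<in>A. c l * unit_exp (of_int l * x)))\<^sup>2)
      = (\<Sum>l\<in>A. \<Sum>k\<in>A. (c l * cnj (c k)) * unit_exp (of_int (l - k) * x))" for x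
    by (simp add: complex_norm_square cnj_sum sum_product cnj_unit_exp unit_exp_add [symmetric]
          algebra_simps del: of_real_power)
  have "((\<lambda>x. \<Sum>l\<in>A. \<Sum>k\<in>A. (c l * cnj (c k)) * unit_exp (of_int (l - k) * x)) has_integral
      (\<Sum>l\<in>A. \<Sum>k\<in>A. (c l * cnj (c k)) * (if l - k = 0 then 1 else 0))) {0..1}"
    by (intro has_integral_sum assms has_integral_mult_right has_integral_unit_exp)
  also have "(\<Sum>l\<in>A. \<Sum>k\<in>A. (c l * cnj (c k)) * (if l - k = 0 then 1 else 0))
      = (\<Sum>l\<in>A. of_real ((cmod (c l))\<^sup>2))"
    using assms
    by (simp add: complex_norm_square if_distrib[of "\<lambda>c. _ * c"] del: of_real_power cong: if_cong)
  finally have "((\<lambda>x. complex_of_real ((cmod (\<Sum>l\<in>A. c l * unit_exp (of_int l * x)))\<^sup>2)) has_integral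
      of_real (\<Sum>l\<in>A. (cmod (c l))\<^sup>2)) {0..1}"
    by (simp only: eq of_real_sum)
  from has_integral_linear[OF this bounded_linear_Re] show ?thesis
    by (simp add: o_def del: of_real_power of_real_sum)
qed

lemma fiber_Parseval:
  assumes "finite {p. u p \<noteq> 0}"
  shows "((\<lambda>x. (ell2_norm (fiber x u))\<^sup>2) has_integral lattice_sq u) {0..1}"
proof -
  let ?N = "fst ` {p. u p \<noteq> 0}" and ?A = "snd ` {p. u p \<noteq> 0}"
  have fin: "finite ?N" "finite ?A" using assms by auto
  have row: "u (n, l) = 0" if "n \<notin> ?N" for n l using that by force
  have col: "u (n, l) = 0" if "l \<notin> ?A" for n l using that by force
  have "fiber x u n = 0" if "n \<notin> ?N" for x n
    using row[OF that] by (simp add: fiber_def)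
  hence "(ell2_norm (fiber x u))\<^sup>2 = (\<Sum>n\<in>?N. (cmod (\<Sum>l\<in>?A. u (n, l) * unit_exp (of_int l * x)))\<^sup>2)" for x
    using ell2_finite_support(2)[OF fin(1), of "fiber x u"] fiber_eq_sum[where u = u, OF fin(2) col] by simp
  moreover have "lattice_sq u = (\<Sum>n\<in>?N. \<Sum>l\<in>?A. (cmod (u (n, l)))\<^sup>2)"
    unfolding sum.cartesian_product
  proof (subst lattice_sq_eq[of "?N \<times> ?A"])
    show "u p = 0" if "p \<notin> ?N \<times> ?A" for p
      using that row col by (cases p) blast
  qed (use fin in \<open>auto intro!: sum.cong\<close>)
  moreover have "((\<lambda>x. \<Sum>n\<in>?N. (cmod (\<Sum>l\<in>?A. u (n, l) * unit_exp (of_int l * x)))\<^sup>2) has_integral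
      (\<Sum>n\<in>?N. \<Sum>l\<in>?A. (cmod (u (n, l)))\<^sup>2)) {0..1}"
    by (intro has_integral_sum fin trig_Parseval)
  ultimately show ?thesis by simp
qed

section \<open>The operator of a symbol on the square lattice\<close>

context rotation_algebra
begin

text \<open>The factor \<open>e (j * x)\<close> of the operator at phase \<open>x\<close> has become a shift by \<open>j\<close> in the second
variable; the factor \<open>e (j * n * \<alpha>)\<close> remains.\<close>

definition lattice_op ::
    "(int \<times> int \<Rightarrow> complex) \<Rightarrow> (int \<times> int \<Rightarrow> complex) \<Rightarrow> int \<times> int \<Rightarrow> complex" where
  "lattice_op a u s =
     (\<Sum>p\<in>box. a p * unit_exp (of_int (snd p) * of_int (fst s) * \<alpha>) * u (fst s + fst p, snd s - snd p))"

lemma finite_support_lattice_op: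
  assumes "finite {p. u p \<noteq> 0}"
  shows "finite {p. lattice_op a u p \<noteq> 0}"
proof (rule finite_subset)
  show "{s. lattice_op a u s \<noteq> 0} \<subseteq> (\<Union>p\<in>box. (\<lambda>s. (fst s - fst p, snd s + snd p)) ` {s. u s \<noteq> 0})"
  proof
    fix s assume "s \<in> {s. lattice_op a u s \<noteq> 0}"
    then obtain p where p: "p \<in> box" "u (fst s + fst p, snd s - snd p) \<noteq> 0"
      unfolding lattice_op_def by (auto elim!: sum.not_neutral_contains_not_neutral)
    hence "s \<in> (\<lambda>s. (fst s - fst p, snd s + snd p)) ` {s. u s \<noteq> 0}"
      by (intro image_eqI[of _ _ "(fst s + fst p, snd s - snd p)"]) auto
    with p(1) show "s \<in> (\<Union>p\<in>box. (\<lambda>s. (fst s - fst p, snd s + snd p)) ` {s. u s \<noteq> 0})" by blast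
  qed
qed (use assms finite_box in auto)

lemma fiber_lattice_op:
  assumes "finite {p. u p \<noteq> 0}"
  shows "fiber x (lattice_op a u) = fiber_op a x (fiber x u)"
proof
  fix n
  let ?c = "\<lambda>p. a p * unit_exp (of_int (snd p) * (x + of_int n * \<alpha>))"
  let ?f = "\<lambda>p l. u (n + fst p, l) * unit_exp (of_int l * x)"
  have sum: "((\<lambda>l. ?c p * ?f p (l - snd p)) has_sum ?c p * fiber x u (n + fst p)) UNIV" for p
  proof (intro has_sum_cmult_right)
    have "(?f p has_sum fiber x u (n + fst p)) UNIV"
      unfolding fiber_def by (rule has_sum_infsum[OF fiber_summable[OF assms]])
    thus "((\<lambda>l. ?f p (l - snd p)) has_sum fiber x u (n + fst p)) UNIV"
      using has_sum_reindex_bij_betw[OF bij_int_shift, of "?f p" "- snd p"] by simp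
  qed
  have "lattice_op a u (n, l) * unit_exp (of_int l * x) = (\<Sum>p\<in>box. ?c p * ?f p (l - snd p))" for l
    unfolding lattice_op_def sum_distrib_right
  proof (rule sum.cong)
    fix p :: "int \<times> int"
    have "unit_exp (of_int (snd p) * of_int n * \<alpha>) * unit_exp (of_int l * x)
        = unit_exp (of_int (snd p) * (x + of_int n * \<alpha>)) * unit_exp (of_int (l - snd p) * x)"
      by (simp add: unit_exp_add [symmetric] algebra_simps)
    thus "a p * unit_exp (of_int (snd p) * of_int (fst (n, l)) * \<alpha>) * u (fst (n, l) + fst p, snd (n, l) - snd p) *
        unit_exp (of_int l * x) = ?c p * ?f p (l - snd p)"
      by (simp add: mult_ac)
  qed simp
  moreover have "((\<lambda>l. \<Sum>p\<in>box. ?c p * ?f p (l - snd p)) has_sum (\<Sum>p\<in>box. ?c p * fiber x u (n + fst p))) UNIV"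
    by (rule has_sum_finite_sum[OF sum finite_box])
  ultimately show "fiber x (lattice_op a u) n = fiber_op a x (fiber x u) n"
    by (simp add: fiber_def[of x "lattice_op a u"] fiber_op_def infsumI)
qed

text \<open>The iteration stays among finitely supported functions, where it runs for all phases at once.\<close>

lemma lattice_residual:
  assumes "finite {p. v p \<noteq> 0}"
  shows "finite {p. residual (lattice_op a) (lattice_op b) t v m p \<noteq> 0}"
    and "fiber x (residual (lattice_op a) (lattice_op b) t v m)
           = residual (fiber_op a x) (fiber_op b x) t (fiber x v) m"
proof -
  let ?r = "residual (lattice_op a) (lattice_op b) t v"
  have eq: "?r (Suc m) = (\<lambda>p. ?r m p + (- of_real t) * lattice_op a (lattice_op b (?r m)) p)" for m
    by simp
  have fin: "finite {p. ?r m p \<noteq> 0}" for m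
  proof (induction m)
    case (Suc m)
    show ?case unfolding eq by (intro finite_support_linear finite_support_lattice_op Suc)
  qed (use assms in simp)
  show "finite {p. ?r m p \<noteq> 0}" by (rule fin)
  show "fiber x (?r m) = residual (fiber_op a x) (fiber_op b x) t (fiber x v) m"
  proof (induction m)
    case (Suc m)
    have "fiber x (?r (Suc m)) n = fiber x (?r m) n + (- of_real t) * fiber x (lattice_op a (lattice_op b (?r m))) n" for n
      unfolding eq by (intro fiber_linear fin finite_support_lattice_op)
    thus ?case
      using Suc by (simp add: fun_eq_iff fiber_lattice_op finite_support_lattice_op fin)
  qed simp
qed

lemma lattice_approximant:
  assumes "finite {p. v p \<noteq> 0}"
  shows "finite {p. approximant (lattice_op a) (lattice_op b) t v m p \<noteq> 0}"
    and "fiber x (approximant (lattice_op a) (lattice_op b) t v m)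
           = approximant (fiber_op a x) (fiber_op b x) t (fiber x v) m"
proof -
  let ?r = "residual (lattice_op a) (lattice_op b) t v" and ?w = "approximant (lattice_op a) (lattice_op b) t v"
  have eq: "?w (Suc m) = (\<lambda>p. ?w m p + of_real t * lattice_op b (?r m) p)" for m
    by simp
  have fin: "finite {p. ?w m p \<noteq> 0}" for m
  proof (induction m)
    case (Suc m)
    show ?case
      unfolding eq by (intro finite_support_linear finite_support_lattice_op Suc lattice_residual(1) assms)
  qed simp
  show "finite {p. ?w m p \<noteq> 0}" by (rule fin)
  show "fiber x (?w m) = approximant (fiber_op a x) (fiber_op b x) t (fiber x v) m"
  proof (induction m)
    case 0
    show ?case by (simp add: fiber_def fun_eq_iff)
  next
    case (Suc m)
    have "fiber x (?w (Suc m)) n = fiber x (?w m) n + of_real t * fiber x (lattice_op b (?r m)) n" for n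
      unfolding eq by (intro fiber_linear fin finite_support_lattice_op lattice_residual(1) assms)
    thus ?case
      using Suc by (simp add: fun_eq_iff fiber_lattice_op lattice_residual assms)
  qed
qed

definition lattice_bounded_below :: "real \<Rightarrow> (int \<times> int \<Rightarrow> complex) \<Rightarrow> bool" where
  "lattice_bounded_below C a \<longleftrightarrow>
     (\<forall>u. finite {p. u p \<noteq> 0} \<longrightarrow> lattice_sq u \<le> C\<^sup>2 * lattice_sq (lattice_op a u))"

text \<open>By Parseval's identity this is the integral, over the phase, of the squared inequality for the
fibers.\<close>

lemma lattice_bounded_below_if_bounded_below:
  assumes "bounded_below C a"
  shows "lattice_bounded_below C a"
  unfolding lattice_bounded_below_def
proof (intro allI impI)
  fix u :: "int \<times> int \<Rightarrow> complex" assume fin: "finite {p. u p \<noteq> 0}"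
  have "(ell2_norm (fiber x u))\<^sup>2 \<le> C\<^sup>2 * (ell2_norm (fiber x (lattice_op a u)))\<^sup>2" for x
  proof -
    have "ell2_norm (fiber x u) \<le> C * ell2_norm (fiber x (lattice_op a u))"
      using assms finite_support_fiber[OF fin] by (simp add: bounded_below_def fiber_lattice_op fin)
    from power_mono[OF this ell2_norm_nonneg, of 2] show ?thesis
      by (simp add: power_mult_distrib)
  qed
  thus "lattice_sq u \<le> C\<^sup>2 * lattice_sq (lattice_op a u)"
    by (intro has_integral_le[OF fiber_Parseval[OF fin]
          has_integral_mult_right[OF fiber_Parseval[OF finite_support_lattice_op[OF fin]]]]) auto
qed

text \<open>The product of \<open>u n\<close> with the plane wave \<open>e (- l * x)\<close>, cut off at \<open>\<bar>l\<bar> \<le> L\<close>, has fibers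
concentrated near the phase \<open>x\<close>. Each of its \<open>2 * L + 1\<close> rows has the norm of \<open>u\<close>. The lattice
operator acts like the operator at phase \<open>x\<close> on the rows with \<open>\<bar>l\<bar> \<le> L - D\<close>, and gives \<open>0\<close> on
those with \<open>\<bar>l\<bar> > L + D\<close>. The \<open>4 * D\<close> rows between them contribute a bounded amount, which
disappears after division by \<open>2 * L + 1\<close> as \<open>L\<close> tends to infinity.\<close>

lemma bounded_below_if_lattice_bounded_below:
  assumes below: "lattice_bounded_below C a" and C: "0 \<le> C"
  shows "bounded_below C a"
  unfolding bounded_below_def
proof (intro allI impI)
  fix x :: real and u :: "int \<Rightarrow> complex" assume fin: "finite {n. u n \<noteq> 0}"
  define w where "w L s = (if \<bar>snd s\<bar> \<le> int L then u (fst s) * unit_exp (- of_int (snd s) * x) else 0)"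
    for L :: nat and s :: "int \<times> int"
  \<comment> \<open>A bound for the entries in the boundary rows, whatever part of the sum the cutoff removes.\<close>
  define E where "E n = (\<Sum>p\<in>box. cmod (a p) * cmod (u (n + fst p)))" for n
  define F where "F = (\<Union>p\<in>box. (\<lambda>n. n - fst p) ` {n. u n \<noteq> 0})"
  define K where "K = (\<Sum>n\<in>F. (E n)\<^sup>2)"
  let ?U = "(ell2_norm u)\<^sup>2" and ?V = "(ell2_norm (fiber_op a x u))\<^sup>2"
  have F: "finite F" using fin finite_box by (simp add: F_def)
  have u0: "u (n + fst p) = 0" if "n \<notin> F" "p \<in> box" for n p
  proof (rule ccontr)
    assume "u (n + fst p) \<noteq> 0"
    hence "n \<in> (\<lambda>n. n - fst p) ` {n. u n \<noteq> 0}" by (intro image_eqI[of _ _ "n + fst p"]) auto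
    thus False using that by (auto simp: F_def)
  qed
  have w_op: "lattice_op a (w L) (n, l) = unit_exp (- of_int l * x) *
      (\<Sum>p\<in>box. if \<bar>l - snd p\<bar> \<le> int L then a p * unit_exp (of_int (snd p) * (x + of_int n * \<alpha>)) * u (n + fst p) else 0)"
    for L n l
    unfolding lattice_op_def sum_distrib_left
  proof (rule sum.cong)
    fix p :: "int \<times> int"
    have "unit_exp (of_int (snd p) * of_int n * \<alpha>) * unit_exp (- of_int (l - snd p) * x)
        = unit_exp (- of_int l * x) * unit_exp (of_int (snd p) * (x + of_int n * \<alpha>))"
      by (simp add: unit_exp_add [symmetric] algebra_simps)
    thus "a p * unit_exp (of_int (snd p) * of_int (fst (n, l)) * \<alpha>) * w L (fst (n, l) + fst p, snd (n, l) - snd p)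
        = unit_exp (- of_int l * x) *
          (if \<bar>l - snd p\<bar> \<le> int L then a p * unit_exp (of_int (snd p) * (x + of_int n * \<alpha>)) * u (n + fst p) else 0)"
      by (simp add: w_def mult_ac)
  qed simp
  have box_snd: "\<bar>snd p\<bar> \<le> int D" if "p \<in> box" for p
    using that by (auto simp: box_def)
  have main: "(2 * real L + 1) * ?U \<le> C\<^sup>2 * ((2 * real L + 1) * ?V + 4 * real D * K)" if L: "D \<le> L" for L
  proof -
    \<comment> \<open>The rows of the packet, the rows that its image can reach, and the rows that do not feel the cutoff.\<close>
    let ?I = "{- int L..int L}" and ?J = "{- int (L + D)..int (L + D)}" and ?H = "{- int (L - D)..int (L - D)}"
    have IJ: "?I \<subseteq> ?J" "?H \<subseteq> ?I" "?H \<subseteq> ?J" by auto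
    have sup_w: "w L s = 0" if "s \<notin> {n. u n \<noteq> 0} \<times> ?I" for s
      using that by (cases s) (auto simp: w_def)
    have fin_w: "finite {s. w L s \<noteq> 0}"
      by (rule finite_subset[of _ "{n. u n \<noteq> 0} \<times> ?I"]) (use sup_w fin in auto)
    have "lattice_sq (w L) = (\<Sum>n | u n \<noteq> 0. \<Sum>l\<in>?I. (cmod (w L (n, l)))\<^sup>2)"
      unfolding sum.cartesian_product
      by (subst lattice_sq_eq[OF _ sup_w]) (use fin in \<open>auto intro!: sum.cong\<close>)
    also have "\<dots> = (\<Sum>n | u n \<noteq> 0. (2 * real L + 1) * (cmod (u n))\<^sup>2)"
    proof (intro sum.cong refl)
      fix n
      have "(\<Sum>l\<in>?I. (cmod (w L (n, l)))\<^sup>2) = (\<Sum>l\<in>?I. (cmod (u n))\<^sup>2)"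
        by (intro sum.cong) (auto simp: w_def norm_mult norm_unit_exp)
      thus "(\<Sum>l\<in>?I. (cmod (w L (n, l)))\<^sup>2) = (2 * real L + 1) * (cmod (u n))\<^sup>2" by simp
    qed
    also have "\<dots> = (2 * real L + 1) * ?U"
      using ell2_finite_support(2)[OF fin] by (simp add: sum_distrib_left)
    finally have lhs: "lattice_sq (w L) = (2 * real L + 1) * ?U" .
    have sup_op: "lattice_op a (w L) s = 0" if "s \<notin> F \<times> ?J" for s
    proof (cases s)
      case (Pair n l)
      have "(if \<bar>l - snd p\<bar> \<le> int L then a p * unit_exp (of_int (snd p) * (x + of_int n * \<alpha>)) * u (n + fst p) else 0) = 0"
        if p: "p \<in> box" for p
        using u0[OF _ p, of n] box_snd[OF p] \<open>s \<notin> F \<times> ?J\<close> Pair by auto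
      thus ?thesis unfolding Pair w_op by simp
    qed
    have pt: "(cmod (lattice_op a (w L) (n, l)))\<^sup>2
        \<le> (if l \<in> ?I then (cmod (fiber_op a x u n))\<^sup>2 else 0) + (if l \<in> ?J - ?H then (E n)\<^sup>2 else 0)"
      if "l \<in> ?J" for n l
    proof (cases "l \<in> ?H")
      case True
      have "\<bar>l - snd p\<bar> \<le> int L" if "p \<in> box" for p
        using True box_snd[OF that] L by auto
      hence "lattice_op a (w L) (n, l) = unit_exp (- of_int l * x) * fiber_op a x u n"
        unfolding w_op fiber_op_def by simp
      thus ?thesis using True IJ by (auto simp: norm_mult norm_unit_exp)
    next
      case False
      have "cmod (lattice_op a (w L) (n, l)) \<le> E n"
        unfolding w_op norm_mult norm_unit_exp mult_1 E_def
        by (rule sum_norm_le) (auto simp: norm_mult norm_unit_exp)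
      hence "(cmod (lattice_op a (w L) (n, l)))\<^sup>2 \<le> (E n)\<^sup>2" by (intro power_mono) auto
      thus ?thesis using False that by (auto simp: add_increasing)
    qed
    have "lattice_sq (lattice_op a (w L)) = (\<Sum>n\<in>F. \<Sum>l\<in>?J. (cmod (lattice_op a (w L) (n, l)))\<^sup>2)"
      unfolding sum.cartesian_product
      by (subst lattice_sq_eq[OF _ sup_op]) (use F in \<open>auto intro!: sum.cong\<close>)
    also have "\<dots> \<le> (\<Sum>n\<in>F. \<Sum>l\<in>?J. (if l \<in> ?I then (cmod (fiber_op a x u n))\<^sup>2 else 0) + (if l \<in> ?J - ?H then (E n)\<^sup>2 else 0))"
      by (intro sum_mono pt)
    also have "\<dots> = (\<Sum>n\<in>F. (2 * real L + 1) * (cmod (fiber_op a x u n))\<^sup>2 + 4 * real D * (E n)\<^sup>2)"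
    proof (intro sum.cong refl)
      fix n
      have "card (?J - ?H) = card ?J - card ?H"
        by (rule card_Diff_subset) (use IJ in auto)
      hence card: "real (card (?J - ?H)) = 4 * real D" using L by simp
      have "(\<Sum>l\<in>?J. if l \<in> ?I then (cmod (fiber_op a x u n))\<^sup>2 else 0) = (2 * real L + 1) * (cmod (fiber_op a x u n))\<^sup>2"
        using IJ(1) by (subst sum.inter_restrict [symmetric]) (auto simp: Int_absorb1)
      moreover have "(\<Sum>l\<in>?J. if l \<in> ?J - ?H then (E n)\<^sup>2 else 0) = 4 * real D * (E n)\<^sup>2"
      proof -
        have "?J \<inter> (?J - ?H) = ?J - ?H" by blast
        hence "(\<Sum>l\<in>?J. if l \<in> ?J - ?H then (E n)\<^sup>2 else 0) = (\<Sum>l\<in>?J - ?H. (E n)\<^sup>2)"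
          by (subst sum.inter_restrict [symmetric]) simp_all
        thus ?thesis by (simp only: sum_constant card)
      qed
      ultimately show "(\<Sum>l\<in>?J. (if l \<in> ?I then (cmod (fiber_op a x u n))\<^sup>2 else 0) + (if l \<in> ?J - ?H then (E n)\<^sup>2 else 0))
          = (2 * real L + 1) * (cmod (fiber_op a x u n))\<^sup>2 + 4 * real D * (E n)\<^sup>2"
        by (simp only: sum.distrib)
    qed
    also have "\<dots> = (2 * real L + 1) * ?V + 4 * real D * K"
    proof -
      have "fiber_op a x u n = 0" if "n \<notin> F" for n
        using u0[OF that] by (simp add: fiber_op_def)
      thus ?thesis
        using ell2_finite_support(2)[OF F, of "fiber_op a x u"] by (simp add: sum.distrib sum_distrib_left K_def)
    qed
    finally have "lattice_sq (lattice_op a (w L)) \<le> (2 * real L + 1) * ?V + 4 * real D * K" .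
    moreover have "lattice_sq (w L) \<le> C\<^sup>2 * lattice_sq (lattice_op a (w L))"
      using below fin_w by (simp add: lattice_bounded_below_def)
    ultimately show ?thesis
      unfolding lhs by (meson mult_left_mono order_trans zero_le_power2)
  qed
  have "?U \<le> C\<^sup>2 * ?V + C\<^sup>2 * (4 * real D * K) * (1 / (2 * real L + 1))" if "D \<le> L" for L
  proof -
    have "?U \<le> C\<^sup>2 * ((2 * real L + 1) * ?V + 4 * real D * K) / (2 * real L + 1)"
      using main[OF that] by (subst pos_le_divide_eq) (auto simp: mult_ac)
    also have "\<dots> = C\<^sup>2 * ?V + C\<^sup>2 * (4 * real D * K) * (1 / (2 * real L + 1))"
      by (simp add: field_simps)
    finally show ?thesis .
  qed
  moreover have "(\<lambda>L. C\<^sup>2 * ?V + C\<^sup>2 * (4 * real D * K) * (1 / (2 * real L + 1)))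
      \<longlonglongrightarrow> C\<^sup>2 * ?V + C\<^sup>2 * (4 * real D * K) * 0"
  proof (intro tendsto_intros)
    show "(\<lambda>L. 1 / (2 * real L + 1)) \<longlonglongrightarrow> 0"
      by (rule tendsto_sandwich[OF _ _ tendsto_const LIMSEQ_inverse_real_of_nat])
         (auto simp: inverse_eq_divide intro!: always_eventually divide_left_mono)
  qed
  ultimately have "?U \<le> C\<^sup>2 * ?V"
    by (intro LIMSEQ_le_const) auto
  hence "?U \<le> (C * ell2_norm (fiber_op a x u))\<^sup>2"
    by (simp add: power_mult_distrib)
  thus "ell2_norm u \<le> C * ell2_norm (fiber_op a x u)"
    by (rule power2_le_imp_le) (intro mult_nonneg_nonneg C ell2_norm_nonneg)
qed

end

section \<open>Aubry duality as a quarter turn of the square lattice\<close>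

context rotation_algebra
begin

text \<open>The quarter turn \<open>(k, j) \<mapsto> (j, - k)\<close> exchanges hopping and frequency. It preserves the commutation
relation between the shift and the multiplication operators, which the plain swap
\<open>(k, j) \<mapsto> (j, k)\<close> would invert; the phase makes up for the order in which the two factors of a
term are written.\<close>

definition dual_symbol :: "(int \<times> int \<Rightarrow> complex) \<Rightarrow> int \<times> int \<Rightarrow> complex" where
  "dual_symbol a p = unit_exp (of_int (fst p) * of_int (snd p) * \<alpha>) * a (- snd p, fst p)"

text \<open>The implementation of the quarter turn on functions. It is unitary for every centre \<open>N\<close>; the shifts
by \<open>N\<close> and the constant phase \<open>- N * N * \<alpha>\<close> are chosen to fix the basis vector at \<open>(N, 0)\<close>.\<close>

definition duality :: "int \<Rightarrow> (int \<times> int \<Rightarrow> complex) \<Rightarrow> int \<times> int \<Rightarrow> complex" where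
  "duality N u s = unit_exp (of_int ((snd s + N) * fst s - N * N) * \<alpha>) * u (snd s + N, N - fst s)"

lemma bij_rotate_box: "bij_betw (\<lambda>p. (snd p, - fst p)) box box"
  by (rule bij_betwI[where g = "\<lambda>p. (- snd p, fst p)"]) (auto simp: box_def)

lemma symbol_norm_dual: "symbol_norm (dual_symbol a) = symbol_norm a"
proof -
  have "symbol_norm (dual_symbol a) = (\<Sum>p\<in>box. cmod (dual_symbol a (snd p, - fst p)))"
    unfolding symbol_norm_def using sum.reindex_bij_betw[OF bij_rotate_box, of "\<lambda>p. cmod (dual_symbol a p)"] by simp
  thus ?thesis by (simp add: dual_symbol_def symbol_norm_def norm_mult norm_unit_exp)
qed

lemma dual_adjoint_symbol: "dual_symbol (adjoint_symbol a) = adjoint_symbol (dual_symbol a)"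
proof
  fix p
  show "dual_symbol (adjoint_symbol a) p = adjoint_symbol (dual_symbol a) p"
    by (simp add: dual_symbol_def adjoint_symbol_def cnj_unit_exp mult_ac unit_exp_add [symmetric])
qed

text \<open>The sums agree term by term after the quarter turn of the index set, by the identity of phases in the
proof.\<close>

lemma duality_lattice_op: "duality N (lattice_op a u) = lattice_op (dual_symbol a) (duality N u)"
proof
  fix s
  let ?g = "\<lambda>p. dual_symbol a p * unit_exp (of_int (snd p) * of_int (fst s) * \<alpha>) * duality N u (fst s + fst p, snd s - snd p)"
  have "lattice_op (dual_symbol a) (duality N u) s = (\<Sum>p\<in>box. ?g (snd p, - fst p))"
    unfolding lattice_op_def using sum.reindex_bij_betw[OF bij_rotate_box, of ?g] by simp
  also have "\<dots> = duality N (lattice_op a u) s"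
    unfolding duality_def[of N "lattice_op a u"] lattice_op_def sum_distrib_left
  proof (rule sum.cong)
    fix p :: "int \<times> int"
    obtain k j where p: "p = (k, j)" by (cases p)
    obtain b c where s: "s = (b, c)" by (cases s)
    have "unit_exp (of_int j * of_int (- k) * \<alpha>) * unit_exp (of_int (- k) * of_int b * \<alpha>) *
        unit_exp (of_int ((c + k + N) * (b + j) - N * N) * \<alpha>)
      = unit_exp (of_int ((c + N) * b - N * N) * \<alpha>) * unit_exp (of_int j * of_int (c + N) * \<alpha>)"
      unfolding unit_exp_add [symmetric] by (rule arg_cong[of _ _ unit_exp]) (simp add: algebra_simps)
    thus "?g (snd p, - fst p) = unit_exp (of_int ((snd s + N) * fst s - N * N) * \<alpha>) *
        (a p * unit_exp (of_int (snd p) * of_int (fst (snd s + N, N - fst s)) * \<alpha>) *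
          u (fst (snd s + N, N - fst s) + fst p, snd (snd s + N, N - fst s) - snd p))"
      by (simp add: p s dual_symbol_def duality_def mult_ac add_ac diff_diff_eq)
  qed simp
  finally show "duality N (lattice_op a u) s = lattice_op (dual_symbol a) (duality N u) s" by simp
qed

lemma duality_finite_support:
  assumes "finite {p. u p \<noteq> 0}"
  shows "finite {p. duality N u p \<noteq> 0}" and "lattice_sq (duality N u) = lattice_sq u"
proof -
  have b: "bij_betw (\<lambda>s. (snd s + N, N - fst s)) {s. duality N u s \<noteq> 0} {p. u p \<noteq> 0}"
    by (rule bij_betwI[where g = "\<lambda>s. (N - snd s, fst s - N)"])
       (auto simp: duality_def unit_exp_nonzero)
  show "finite {p. duality N u p \<noteq> 0}"
    using bij_betw_finite[OF b] assms by simp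
  show "lattice_sq (duality N u) = lattice_sq u"
    unfolding lattice_sq_def using sum.reindex_bij_betw[OF b, of "\<lambda>p. (cmod (u p))\<^sup>2"]
    by (simp add: duality_def norm_mult norm_unit_exp)
qed

lemma duality_surj:
  assumes "finite {p. v p \<noteq> 0}"
  obtains u where "finite {p. u p \<noteq> 0}" "duality 0 u = v"
proof
  define u where "u s = unit_exp (of_int (fst s * snd s) * \<alpha>) * v (- snd s, fst s)" for s
  show "finite {p. u p \<noteq> 0}"
  proof (rule finite_subset)
    show "{p. u p \<noteq> 0} \<subseteq> (\<lambda>s. (snd s, - fst s)) ` {p. v p \<noteq> 0}"
      by (auto simp: u_def image_iff intro!: exI[of _ "- _"])
  qed (use assms in simp)
  show "duality 0 u = v"
  proof
    fix s
    have "unit_exp (of_int (snd s * fst s) * \<alpha>) * unit_exp (of_int (snd s * - fst s) * \<alpha>) = 1"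
      by (simp add: unit_exp_add [symmetric] unit_exp_0)
    thus "duality 0 u s = v s"
      by (simp add: duality_def u_def)
  qed
qed

lemma lattice_bounded_below_dual:
  "lattice_bounded_below C (dual_symbol a) \<longleftrightarrow> lattice_bounded_below C a"
proof
  assume below: "lattice_bounded_below C (dual_symbol a)"
  show "lattice_bounded_below C a"
    unfolding lattice_bounded_below_def
  proof (intro allI impI)
    fix u :: "int \<times> int \<Rightarrow> complex" assume fin: "finite {p. u p \<noteq> 0}"
    show "lattice_sq u \<le> C\<^sup>2 * lattice_sq (lattice_op a u)"
    proof -
      have "lattice_sq (duality 0 u) \<le> C\<^sup>2 * lattice_sq (lattice_op (dual_symbol a) (duality 0 u))"
        using below duality_finite_support(1)[OF fin, of 0] by (simp add: lattice_bounded_below_def)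
      thus ?thesis
        by (simp add: duality_finite_support(2) fin finite_support_lattice_op flip: duality_lattice_op)
    qed
  qed
next
  assume below: "lattice_bounded_below C a"
  show "lattice_bounded_below C (dual_symbol a)"
    unfolding lattice_bounded_below_def
  proof (intro allI impI)
    fix v :: "int \<times> int \<Rightarrow> complex" assume "finite {p. v p \<noteq> 0}"
    then obtain u where fin: "finite {p. u p \<noteq> 0}" and v: "duality 0 u = v"
      by (rule duality_surj)
    show "lattice_sq v \<le> C\<^sup>2 * lattice_sq (lattice_op (dual_symbol a) v)"
      using below fin duality_finite_support(2)[OF fin]
        duality_finite_support(2)[OF finite_support_lattice_op[OF fin]]
      by (simp add: lattice_bounded_below_def duality_lattice_op [symmetric] flip: v)
  qed
qed

lemma bounded_below_dual:
  assumes "0 \<le> C"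
  shows "bounded_below C (dual_symbol a) \<longleftrightarrow> bounded_below C a"
  using lattice_bounded_below_if_bounded_below bounded_below_if_lattice_bounded_below[OF _ assms] lattice_bounded_below_dual by blast

lemma duality_linear:
  "duality N (\<lambda>p. u p + c * v p) s = duality N u s + c * duality N v s"
  by (simp add: duality_def algebra_simps)

lemma duality_lattice_basis: "duality N (lattice_basis N) = lattice_basis N"
  by (auto simp: duality_def lattice_basis_def fun_eq_iff unit_exp_0)

lemma duality_residual:
  "duality N (residual (lattice_op a) (lattice_op b) t v m)
     = residual (lattice_op (dual_symbol a)) (lattice_op (dual_symbol b)) t (duality N v) m"
proof (induction m)
  case (Suc m)
  show ?case
    using duality_linear[of N "residual (lattice_op a) (lattice_op b) t v m" "- of_real t"]
    by (simp add: fun_eq_iff duality_lattice_op Suc)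
qed simp

lemma duality_approximant:
  "duality N (approximant (lattice_op a) (lattice_op b) t v m)
     = approximant (lattice_op (dual_symbol a)) (lattice_op (dual_symbol b)) t (duality N v) m"
proof (induction m)
  case 0
  show ?case by (simp add: duality_def fun_eq_iff)
next
  case (Suc m)
  show ?case
    by (simp add: fun_eq_iff duality_linear duality_lattice_op duality_residual Suc)
qed

text \<open>The quarter turn about \<open>(n, 0)\<close> maps one iteration to the other and preserves values at its
centre.\<close>

lemma approximant_dual_diagonal:
  "approximant (lattice_op (dual_symbol a)) (lattice_op (dual_symbol b)) t (lattice_basis n) m (n, 0)
     = approximant (lattice_op a) (lattice_op b) t (lattice_basis n) m (n, 0)"
proof -
  have "approximant (lattice_op (dual_symbol a)) (lattice_op (dual_symbol b)) t (lattice_basis n) m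
      = duality n (approximant (lattice_op a) (lattice_op b) t (lattice_basis n) m)"
    by (simp add: duality_approximant duality_lattice_basis)
  thus ?thesis by (simp add: duality_def unit_exp_0)
qed

end

section \<open>From one phase to all phases\<close>

context rotation_algebra
begin

text \<open>Translating the phase along the orbit amounts to conjugation by a shift, which is unitary.\<close>

lemma fiber_op_translate:
  "fiber_op a (x + of_int m * \<alpha> + of_int k) u n = fiber_op a x (\<lambda>i. u (i - m)) (n + m)"
  unfolding fiber_op_def
proof (rule sum.cong)
  fix p :: "int \<times> int"
  have "unit_exp (of_int (snd p) * (x + of_int m * \<alpha> + of_int k + of_int n * \<alpha>))
      = unit_exp (of_int (snd p) * (x + of_int (n + m) * \<alpha>) + of_int (snd p * k))"
    by (rule arg_cong[of _ _ unit_exp]) (simp add: algebra_simps)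
  also have "\<dots> = unit_exp (of_int (snd p) * (x + of_int (n + m) * \<alpha>))"
    by (simp only: unit_exp_add unit_exp_of_int mult_1_right)
  finally show "a p * unit_exp (of_int (snd p) * (x + of_int m * \<alpha> + of_int k + of_int n * \<alpha>)) * u (n + fst p)
      = a p * unit_exp (of_int (snd p) * (x + of_int (n + m) * \<alpha>)) * u (n + m + fst p - m)"
    by (simp add: algebra_simps)
qed simp

lemma fiber_op_finite_support:
  assumes "finite {n. u n \<noteq> 0}"
  obtains F where "finite F" "\<And>x n. n \<notin> F \<Longrightarrow> fiber_op a x u n = 0"
proof
  let ?F = "\<Union>p\<in>box. (\<lambda>n. n - fst p) ` {n. u n \<noteq> 0}"
  show "finite ?F" using assms finite_box by simp
  show "fiber_op a x u n = 0" if n: "n \<notin> ?F" for x n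
    unfolding fiber_op_def
  proof (rule sum.neutral, rule ballI)
    fix p assume p: "p \<in> box"
    have "u (n + fst p) = 0"
    proof (rule ccontr)
      assume "u (n + fst p) \<noteq> 0"
      hence "n \<in> (\<lambda>n. n - fst p) ` {n. u n \<noteq> 0}" by (intro image_eqI[of _ _ "n + fst p"]) auto
      thus False using n p by blast
    qed
    thus "a p * unit_exp (of_int (snd p) * (x + of_int n * \<alpha>)) * u (n + fst p) = 0" by simp
  qed
qed

text \<open>This is Kronecker's theorem, applied to the fractional part of \<open>x - x0\<close>.\<close>

lemma orbit_dense:
  assumes "\<alpha> \<notin> \<rat>"
  shows "x \<in> closure {y. \<exists>m k. y = x0 + of_int m * \<alpha> + of_int k}"
  unfolding closure_approachable
proof (intro allI impI)
  fix e :: real assume "0 < e"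
  then obtain m :: nat where m: "\<bar>frac (real m * \<alpha>) - frac (x - x0)\<bar> < e"
    using Kronecker_approx_1_explicit[OF assms, of "frac (x - x0)" e] frac_ge_0 frac_lt_1 less_imp_le by metis
  let ?k = "\<lfloor>x - x0\<rfloor> - \<lfloor>real m * \<alpha>\<rfloor>"
  have "x0 + of_int (int m) * \<alpha> + of_int ?k - x = frac (real m * \<alpha>) - frac (x - x0)"
    by (simp add: frac_def)
  hence "dist (x0 + of_int (int m) * \<alpha> + of_int ?k) x < e"
    using m by (simp only: dist_real_def)
  thus "\<exists>y\<in>{y. \<exists>m k. y = x0 + of_int m * \<alpha> + of_int k}. dist y x < e" by blast
qed

text \<open>For fixed \<open>u\<close> the set of phases at which the inequality holds is closed, since the squared norms
are finite sums of continuous functions of the phase, and it contains the dense orbit of \<open>x0\<close>.\<close>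

lemma bounded_below_if_single_fiber:
  assumes \<alpha>: "\<alpha> \<notin> \<rat>" and C: "0 \<le> C"
    and below: "\<And>u. finite {n. u n \<noteq> 0} \<Longrightarrow> ell2_norm u \<le> C * ell2_norm (fiber_op a x0 u)"
  shows "bounded_below C a"
  unfolding bounded_below_def
proof (intro allI impI)
  fix x :: real and u :: "int \<Rightarrow> complex" assume fin: "finite {n. u n \<noteq> 0}"
  obtain F where F: "finite F" "\<And>x n. n \<notin> F \<Longrightarrow> fiber_op a x u n = 0"
    using fiber_op_finite_support[OF fin] by blast
  let ?G = "{y. (ell2_norm u)\<^sup>2 \<le> C\<^sup>2 * (\<Sum>n\<in>F. (cmod (fiber_op a y u n))\<^sup>2)}"
  have sq: "(ell2_norm (fiber_op a y u))\<^sup>2 = (\<Sum>n\<in>F. (cmod (fiber_op a y u n))\<^sup>2)" for y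
    using ell2_finite_support(2)[OF F(1)] F(2) by blast
  have "closed ?G"
    unfolding fiber_op_def by (intro closed_Collect_le continuous_intros)
  moreover have "{y. \<exists>m k. y = x0 + of_int m * \<alpha> + of_int k} \<subseteq> ?G"
  proof clarify
    fix m k :: int
    let ?y = "x0 + of_int m * \<alpha> + of_int k" and ?v = "\<lambda>i. u (i - m)"
    have u: "u \<in> ell2" using ell2_finite_support(1)[OF fin] by simp
    have v: "?v \<in> ell2" "ell2_norm ?v = ell2_norm u"
      using ell2_weighted_shift[OF u, of "\<lambda>_. 1" 1 "- m"] by simp_all
    have "{n. ?v n \<noteq> 0} = (\<lambda>n. n + m) ` {n. u n \<noteq> 0}"
      by (auto intro!: image_eqI[of _ _ "_ - m"])
    hence "ell2_norm ?v \<le> C * ell2_norm (fiber_op a x0 ?v)"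
      using fin by (intro below) simp
    also have "ell2_norm (fiber_op a x0 ?v) = ell2_norm (fiber_op a ?y u)"
      using ell2_weighted_shift(2)[OF fiber_op_ell2(1)[OF v(1), of a x0], of "\<lambda>_. 1" 1 m]
      by (simp add: fiber_op_translate [abs_def])
    finally have "(ell2_norm u)\<^sup>2 \<le> (C * ell2_norm (fiber_op a ?y u))\<^sup>2"
      unfolding v(2) by (intro power_mono ell2_norm_nonneg)
    thus "(ell2_norm u)\<^sup>2 \<le> C\<^sup>2 * (\<Sum>n\<in>F. (cmod (fiber_op a ?y u n))\<^sup>2)"
      by (simp add: power_mult_distrib sq)
  qed
  ultimately have "x \<in> ?G"
    using orbit_dense[OF \<alpha>, of x x0] closure_minimal by blast
  hence "(ell2_norm u)\<^sup>2 \<le> (C * ell2_norm (fiber_op a x u))\<^sup>2"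
    by (simp add: power_mult_distrib sq)
  thus "ell2_norm u \<le> C * ell2_norm (fiber_op a x u)"
    by (rule power2_le_imp_le) (intro mult_nonneg_nonneg C ell2_norm_nonneg)
qed

text \<open>With the spectral parameter absorbed into \<open>a (0, 0)\<close>, this says that it lies in the resolvent set.\<close>

definition fiber_invertible :: "(int \<times> int \<Rightarrow> complex) \<Rightarrow> real \<Rightarrow> bool" where
  "fiber_invertible a x \<longleftrightarrow> bij_betw (fiber_op a x) ell2 ell2 \<and>
     (\<exists>C. \<forall>u\<in>ell2. ell2_norm u \<le> C * ell2_norm (fiber_op a x u))"

text \<open>The adjoint of an invertible operator is bounded below: if \<open>u\<close> is the image of \<open>w\<close>, then
\<open>\<parallel>u\<parallel>\<^sup>2\<close> is the inner product of \<open>w\<close> with the image of \<open>u\<close> under the adjoint, and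
\<open>\<parallel>w\<parallel> \<le> C * \<parallel>u\<parallel>\<close>.\<close>

lemma bounded_below_if_fiber_invertible:
  assumes \<alpha>: "\<alpha> \<notin> \<rat>" and inv: "fiber_invertible a x"
  obtains C where "1 \<le> C" "bounded_below C a" "bounded_below C (adjoint_symbol a)"
proof -
  obtain C0 where C0: "\<And>u. u \<in> ell2 \<Longrightarrow> ell2_norm u \<le> C0 * ell2_norm (fiber_op a x u)"
    using inv by (auto simp: fiber_invertible_def)
  define C where "C = max 1 C0"
  have C: "1 \<le> C" by (simp add: C_def)
  have below: "ell2_norm u \<le> C * ell2_norm (fiber_op a x u)" if "u \<in> ell2" for u
    using C0[OF that] mult_right_mono[of C0 C "ell2_norm (fiber_op a x u)"]
    by (simp add: C_def ell2_norm_nonneg)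
  have "ell2_norm u \<le> C * ell2_norm (fiber_op (adjoint_symbol a) x u)" if u: "u \<in> ell2" for u
  proof (cases "ell2_norm u = 0")
    case False
    obtain w where w: "w \<in> ell2" "fiber_op a x w = u"
      using inv u unfolding fiber_invertible_def bij_betw_def by (metis imageE)
    let ?s = "fiber_op (adjoint_symbol a) x u"
    have "(ell2_norm u)\<^sup>2 = cmod (ell2_inner u u)"
      by (simp add: ell2_inner_self[OF u] norm_power ell2_norm_nonneg)
    also have "\<dots> = cmod (ell2_inner w ?s)"
      using fiber_op_adjoint[OF w(1) u, of a x] w(2) by simp
    also have "\<dots> \<le> ell2_norm w * ell2_norm ?s"
      by (rule ell2_Cauchy_Schwarz[OF w(1) fiber_op_ell2(1)[OF u]])
    also have "\<dots> \<le> (C * ell2_norm u) * ell2_norm ?s"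
      using below[OF w(1)] w(2) by (intro mult_right_mono) (auto simp: ell2_norm_nonneg)
    finally have "ell2_norm u * ell2_norm u \<le> ell2_norm u * (C * ell2_norm ?s)"
      by (simp add: power2_eq_square mult_ac)
    thus ?thesis
      using False ell2_norm_nonneg[of u] by (simp add: mult_le_cancel_left)
  qed (use C in \<open>simp add: ell2_norm_nonneg\<close>)
  hence "bounded_below C (adjoint_symbol a)"
    using C ell2_finite_support(1) by (intro bounded_below_if_single_fiber[OF \<alpha>]) auto
  moreover have "bounded_below C a"
    using C ell2_finite_support(1) below by (intro bounded_below_if_single_fiber[OF \<alpha>]) auto
  ultimately show thesis using that C by blast
qed

end

section \<open>Equality of the diagonal integrals\<close>

lemma torus_integral_continuous:
  assumes "continuous_on {0..1} f"
  shows "torus_integral f = integral {0..1} f"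
proof -
  have "set_integrable lborel {0..<1} f"
    by (rule set_integrable_subset[OF borel_integrable_atLeastAtMost'[OF assms]]) auto
  hence "torus_integral f = integral {0..<1} f"
    unfolding torus_integral_def by (rule set_borel_integral_eq_integral(2))
  also have "{0..<1::real} = {0..1} - {1}" by auto
  also have "integral ({0..1} - {1}) f = integral {0..1} f"
    by (rule integral_spike_set) (auto intro: negligible_subset[of "{1}"])
  finally show ?thesis .
qed

context invertible_symbol
begin

lemma invertible: "fiber_invertible a x"
  unfolding fiber_invertible_def using T_bij T_bounded_below by blast

text \<open>The approximate solutions are trigonometric polynomials in \<open>x\<close> and converge uniformly, so that
integral and limit may be interchanged; the integral picks the Fourier coefficient at \<open>0\<close>.\<close>

lemma lattice_approximant_tendsto:
  "(\<lambda>m. approximant (lattice_op a) (lattice_op (adjoint_symbol a)) t (lattice_basis n) m (n, 0))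
     \<longlonglongrightarrow> torus_integral (\<lambda>x. inv_into ell2 (T x) (ell2_basis n) n)"
proof -
  let ?w = "\<lambda>m. approximant (lattice_op a) (lattice_op (adjoint_symbol a)) t (lattice_basis n) m"
  let ?g = "\<lambda>x. inv_into ell2 (T x) (ell2_basis n) n"
  have fin: "finite {p. ?w m p \<noteq> 0}" for m
    by (rule lattice_approximant(1)[OF finite_support_lattice_basis])
  have err: "dist (fiber x (?w m) n) (?g x) \<le> C * q ^ m" for x m
    using approximant_error[OF ell2_basis_in_ell2(1), of x n m n]
    by (simp add: lattice_approximant(2)[OF finite_support_lattice_basis] fiber_lattice_basis
          ell2_basis_in_ell2(2) dist_norm)
  have tend0: "(\<lambda>m. C * q ^ m) \<longlonglongrightarrow> 0"
    using q_bounds by (intro tendsto_mult_right_zero LIMSEQ_realpow_zero) auto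
  have lim: "uniform_limit {0..1} (\<lambda>m x. fiber x (?w m) n) ?g sequentially"
  proof (rule uniform_limitI)
    fix e :: real assume "0 < e"
    hence "\<forall>\<^sub>F m in sequentially. C * q ^ m < e"
      using order_tendstoD(2)[OF tend0] by blast
    thus "\<forall>\<^sub>F m in sequentially. \<forall>x\<in>{0..1}. dist (fiber x (?w m) n) (?g x) < e"
      by eventually_elim (use err in \<open>blast intro: le_less_trans\<close>)
  qed
  have cont: "continuous_on {0..1} (\<lambda>x. fiber x (?w m) n)" for m
  proof -
    let ?A = "snd ` {p. ?w m p \<noteq> 0}"
    have "fiber x (?w m) n = (\<Sum>l\<in>?A. ?w m (n, l) * unit_exp (of_int l * x))" for x
      using fin[of m] by (intro fiber_eq_sum) force+
    thus ?thesis by (simp only:) (intro continuous_intros)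
  qed
  have "continuous_on {0..1} ?g"
    by (rule uniform_limit_theorem[OF always_eventually lim]) (use cont in auto)
  hence "torus_integral ?g = integral {0..1} ?g"
    by (rule torus_integral_continuous)
  moreover obtain I J where IJ: "\<And>m. ((\<lambda>x. fiber x (?w m) n) has_integral I m) {0..1}"
      "(?g has_integral J) {0..1}" "(I \<longlongrightarrow> J) sequentially"
    by (rule uniform_limit_integral[OF lim cont]) auto
  moreover have "I = (\<lambda>m. ?w m (n, 0))"
    using has_integral_unique[OF IJ(1) integral_fiber[OF fin]] by (intro ext)
  ultimately show ?thesis
    by (simp add: integral_unique)
qed

end

context rotation_algebra
begin

text \<open>If some fiber of either symbol is invertible, then all fibers of both are, with common constants, and
the integrals are limits of the same sequence. Otherwise both integrands are \<open>0\<close>.\<close>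

lemma duality_of_diagonal_integrals:
  assumes \<alpha>: "\<alpha> \<notin> \<rat>"
  shows "torus_integral (\<lambda>x. if fiber_invertible a x then inv_into ell2 (fiber_op a x) (ell2_basis n) n else 0)
       = torus_integral (\<lambda>x. if fiber_invertible (dual_symbol a) x
           then inv_into ell2 (fiber_op (dual_symbol a) x) (ell2_basis n) n else 0)"
proof (cases "(\<exists>x. fiber_invertible a x) \<or> (\<exists>x. fiber_invertible (dual_symbol a) x)")
  case True
  have "\<exists>C. 1 \<le> C \<and> bounded_below C a \<and> bounded_below C (adjoint_symbol a)"
    using True
  proof
    assume "\<exists>x. fiber_invertible a x"
    thus ?thesis using bounded_below_if_fiber_invertible[OF \<alpha>] by metis
  next
    assume "\<exists>x. fiber_invertible (dual_symbol a) x"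
    then obtain C where C: "1 \<le> C" "bounded_below C (dual_symbol a)"
        "bounded_below C (adjoint_symbol (dual_symbol a))"
      using bounded_below_if_fiber_invertible[OF \<alpha>] by metis
    thus ?thesis
      by (intro exI[of _ C]) (simp add: bounded_below_dual flip: dual_adjoint_symbol)
  qed
  then obtain C where C: "1 \<le> C" "bounded_below C a" "bounded_below C (adjoint_symbol a)"
    by blast
  define M where "M = max 1 (symbol_norm a)"
  define t where "t = 1 / (M ^ 4 * C\<^sup>2)"
  have M: "1 \<le> M" "symbol_norm a \<le> M" by (auto simp: M_def)
  have t: "0 < t" "t * M ^ 4 * C\<^sup>2 \<le> 1"
    using M(1) C(1) by (auto simp: t_def)
  interpret P: invertible_symbol \<alpha> D a C M t
    by unfold_locales (use C M t in auto)
  interpret Q: invertible_symbol \<alpha> D "dual_symbol a" C M t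
    by unfold_locales
       (use C M t in \<open>auto simp: symbol_norm_dual bounded_below_dual simp flip: dual_adjoint_symbol\<close>)
  have "(\<lambda>m. approximant (lattice_op a) (lattice_op (adjoint_symbol a)) t (lattice_basis n) m (n, 0))
      \<longlonglongrightarrow> torus_integral (\<lambda>x. inv_into ell2 (fiber_op (dual_symbol a) x) (ell2_basis n) n)"
    using Q.lattice_approximant_tendsto[of n]
    by (simp add: approximant_dual_diagonal flip: dual_adjoint_symbol)
  from LIMSEQ_unique[OF P.lattice_approximant_tendsto this] show ?thesis
    by (simp add: P.invertible Q.invertible)
next
  case False
  thus ?thesis by simp
qed

end

section \<open>The Schroedinger operator and its Aubry dual\<close>

text \<open>The symbol of the Schroedinger operator minus \<open>z\<close>. Shifting the argument of the potential by
\<open>\<i> * \<epsilon>\<close> multiplies its \<open>k\<close>-th coefficient by \<open>exp (- 2 * pi * k * \<epsilon>)\<close>.\<close>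

definition schrodinger_symbol ::
    "nat \<Rightarrow> (int \<Rightarrow> complex) \<Rightarrow> real \<Rightarrow> complex \<Rightarrow> int \<times> int \<Rightarrow> complex" where
  "schrodinger_symbol d V \<epsilon> z p =
     (if p = (1, 0) \<or> p = (-1, 0) then 1 else 0)
     + (if fst p = 0 \<and> \<bar>snd p\<bar> \<le> int d then of_real (exp (- 2 * pi * of_int (snd p) * \<epsilon>)) * V (snd p) else 0)
     - (if p = (0, 0) then z else 0)"

context rotation_algebra
begin

lemma sum_box_schrodinger:
  assumes "D = Suc d"
  shows "(\<Sum>p\<in>box. schrodinger_symbol d V \<epsilon> z p * f p)
       = f (1, 0) + f (-1, 0)
         + (\<Sum>j = - int d..int d. of_real (exp (- 2 * pi * of_int j * \<epsilon>)) * V j * f (0, j)) - z * f (0, 0)"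
proof -
  let ?c = "\<lambda>j. of_real (exp (- 2 * pi * of_int j * \<epsilon>)) * V j"
  have box: "box = {- int (Suc d)..int (Suc d)} \<times> {- int (Suc d)..int (Suc d)}"
    unfolding box_def by (simp only: assms)
  have "(\<Sum>p\<in>box. (if p = (1, 0) \<or> p = (-1, 0) then 1 else 0) * f p) = (\<Sum>p\<in>{(1, 0), (-1, 0)}. f p)"
    by (rule sum.mono_neutral_cong_right) (auto simp: box)
  moreover have "(\<Sum>p\<in>box. (if fst p = 0 \<and> \<bar>snd p\<bar> \<le> int d then ?c (snd p) else 0) * f p)
      = (\<Sum>p\<in>{0} \<times> {- int d..int d}. ?c (snd p) * f p)"
    by (rule sum.mono_neutral_cong_right) (auto simp: box)
  moreover have "(\<Sum>p\<in>{0} \<times> {- int d..int d}. ?c (snd p) * f p) = (\<Sum>j = - int d..int d. ?c j * f (0, j))"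
    by (simp add: sum.cartesian_product')
  moreover have "(\<Sum>p\<in>box. (if p = (0, 0) then z else 0) * f p) = (\<Sum>p\<in>{(0, 0)}. z * f p)"
    by (rule sum.mono_neutral_cong_right) (auto simp: box)
  ultimately show ?thesis
    by (simp add: schrodinger_symbol_def distrib_right left_diff_distrib sum.distrib sum_subtractf)
qed

lemma fiber_op_schrodinger:
  assumes "D = Suc d"
  shows "fiber_op (schrodinger_symbol d V \<epsilon> z) x u n
       = schrodinger_op (trig_poly d V) \<epsilon> x \<alpha> u n - z * u n"
proof -
  have "exp (2 * of_real pi * \<i> * of_int k * (of_real x + \<i> * of_real \<epsilon> + of_int n * of_real \<alpha>))
      = of_real (exp (- 2 * pi * of_int k * \<epsilon>)) * unit_exp (of_int k * (x + of_int n * \<alpha>))" for k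
    by (simp add: unit_exp_def cis_conv_exp exp_of_real [symmetric] exp_add [symmetric] algebra_simps)
  hence "trig_poly d V (of_real x + \<i> * of_real \<epsilon> + of_int n * of_real \<alpha>)
      = (\<Sum>k = - int d..int d. of_real (exp (- 2 * pi * of_int k * \<epsilon>)) * V k * unit_exp (of_int k * (x + of_int n * \<alpha>)))"
    by (simp add: trig_poly_def mult_ac)
  moreover have "fiber_op (schrodinger_symbol d V \<epsilon> z) x u n
      = (\<Sum>p\<in>box. schrodinger_symbol d V \<epsilon> z p *
          (unit_exp (of_int (snd p) * (x + of_int n * \<alpha>)) * u (n + fst p)))"
    by (simp add: fiber_op_def mult.assoc)
  ultimately show ?thesis
    unfolding sum_box_schrodinger[OF assms] by (simp add: schrodinger_op_def unit_exp_0 sum_distrib_right mult.assoc)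
qed

text \<open>The quarter turn moves the hopping terms \<open>(1, 0)\<close> and \<open>(- 1, 0)\<close> to the frequencies \<open>- 1\<close> and
\<open>1\<close>, which add up to the cosine, and moves the \<open>k\<close>-th Fourier mode of the potential to hopping by
\<open>k\<close>. All these indices lie on the axes, where the phase of the dual symbol is \<open>1\<close>.\<close>

lemma fiber_op_dual_schrodinger:
  assumes "D = Suc d"
  shows "fiber_op (dual_symbol (schrodinger_symbol d V \<epsilon> z)) \<theta> u n
       = aubry_dual_op d V \<epsilon> \<theta> \<alpha> u n - z * u n"
proof -
  let ?f = "\<lambda>p. unit_exp (of_int (snd p) * (\<theta> + of_int n * \<alpha>)) * u (n + fst p)"
  have "dual_symbol (schrodinger_symbol d V \<epsilon> z) (snd p, - fst p) = schrodinger_symbol d V \<epsilon> z p" for p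
    by (cases p) (auto simp: dual_symbol_def schrodinger_symbol_def unit_exp_0)
  hence "fiber_op (dual_symbol (schrodinger_symbol d V \<epsilon> z)) \<theta> u n
      = (\<Sum>p\<in>box. schrodinger_symbol d V \<epsilon> z p * ?f (snd p, - fst p))"
    using sum.reindex_bij_betw[OF bij_rotate_box, of "\<lambda>p. dual_symbol (schrodinger_symbol d V \<epsilon> z) p * ?f p"]
    by (simp add: fiber_op_def mult.assoc)
  moreover have "unit_exp s + unit_exp (- s) = of_real (2 * cos (2 * pi * s))" for s
    by (simp add: unit_exp_def complex_eq_iff)
  hence "unit_exp (\<theta> + of_int n * \<alpha>) * u n + unit_exp (- \<theta> - of_int n * \<alpha>) * u n
      = of_real (2 * cos (2 * pi * (\<theta> + of_int n * \<alpha>))) * u n"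
    by (metis distrib_right minus_add_distrib diff_conv_add_uminus)
  ultimately show ?thesis
    unfolding sum_box_schrodinger[OF assms] by (simp add: aubry_dual_op_def unit_exp_0 add.commute)
qed

lemma ell2_inner_resolvent:
  assumes "\<And>u n. fiber_op a x u n = A u n - z * u n"
  shows "ell2_inner (resolvent A z (ell2_basis n)) (ell2_basis n)
       = (if fiber_invertible a x then inv_into ell2 (fiber_op a x) (ell2_basis n) n else 0)"
proof -
  have eq: "fiber_op a x = (\<lambda>u n. A u n - z * u n)"
    by (simp add: assms fun_eq_iff)
  show ?thesis
    unfolding ell2_inner_basis resolvent_def resolvent_set_def fiber_invertible_def eq by auto
qed

end

theorem lemma6p1:
  fixes \<alpha> \<epsilon> :: real and d :: nat and V :: "int \<Rightarrow> complex" and z :: complex and n :: int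
  assumes "\<alpha> \<notin> \<rat>"
    and "real_trig_poly d V"
    and "z \<notin> \<real>"
  shows "torus_integral (\<lambda>x. ell2_inner
            (resolvent (schrodinger_op (trig_poly d V) \<epsilon> x \<alpha>) z (ell2_basis n)) (ell2_basis n)) =
         torus_integral (\<lambda>\<theta>. ell2_inner
            (resolvent (aubry_dual_op d V \<epsilon> \<theta> \<alpha>) z (ell2_basis n)) (ell2_basis n))"
proof -
  \<comment> \<open>The box has to contain the hopping terms also when \<open>d = 0\<close>.\<close>
  interpret rotation_algebra \<alpha> "Suc d" .
  show ?thesis
    unfolding ell2_inner_resolvent[OF fiber_op_schrodinger[OF refl]]
      ell2_inner_resolvent[OF fiber_op_dual_schrodinger[OF refl]]
    by (rule duality_of_diagonal_integrals[OF assms(1)])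
qed

end
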